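(* In the setting described in the context, consider the Hamiltonian $\mathtt H=\mathtt N+\mathtt G$ on $\mathbb C^2$. (i) (Resonant normal form, no condition on the frequencies.) Let $S_{\rm res}$ be the homogeneous quartic polynomial $S_{\rm res}=\sum_{|\boldsymbol\alpha+\boldsymbol\beta|=4}S_{\boldsymbol\alpha,\boldsymbol\beta}\mathbf z^{\boldsymbol\alpha}\bar{\mathbf z}^{\boldsymbol\beta}$ with $S_{\boldsymbol\alpha,\boldsymbol\beta}=\mathrm i\,\mathtt G_{\boldsymbol\alpha,\boldsymbol\beta}/(\boldsymbol\omega\cdot(\boldsymbol\alpha-\boldsymbol\beta))$ whenever $\boldsymbol\alpha\neq\boldsymbol\beta$ and $\boldsymbol\omega\cdot(\boldsymbol\alpha-\boldsymbol\beta)\ne 0$ ... more precisely: whenever $\boldsymbol\alpha\ne\boldsymbol\beta$ and $(\boldsymbol\alpha,\boldsymbol\beta)\notin\{((3,0),(0,1)),((0,1),(3,0))\}$, and $S_{\boldsymbol\alpha,\boldsymbol\beta}=0$ otherwise; it solves $\mathtt G+\{S_{\rm res},\mathtt N\}=\bar{\mathtt H}_{4,{\rm res}}$. Then in a sufficiently small neighbourhood of the origin the time-one Hamiltonian flow $\Phi_{\rm res}:=\Phi^1_{S_{\rm res}}$ is a symplectic transformation with $\Phi_{\rm res}(\mathbf z)=\mathbf z+O(\|\mathbf z\|^3)$, and $$\mathtt H\circ\Phi_{\rm res}=\mathtt N+\bar{\mathtt H}_{4,{\rm res}}+R_{\rm res},\qquad R_{\rm res}=O(\|\mathbf z\|^6).$$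 (ii) (Nonresonant normal form.) If $\omega_+\neq 3\omega_-$, let $S$ be the homogeneous quartic polynomial with coefficients $S_{\boldsymbol\alpha,\boldsymbol\beta}=\mathrm i\,\mathtt G_{\boldsymbol\alpha,\boldsymbol\beta}/(\boldsymbol\omega\cdot(\boldsymbol\alpha-\boldsymbol\beta))$ for $\boldsymbol\alpha\neq\boldsymbol\beta$ and $S_{\boldsymbol\alpha,\boldsymbol\alpha}=0$; it solves $\mathtt G+\{S,\mathtt N\}=\bar{\mathtt H}_4$. Then in a sufficiently small neighbourhood of the origin the time-one flow $\Phi_{\rm nonres}:=\Phi^1_S$ is a symplectic transformation with $\Phi_{\rm nonres}(\mathbf z)=\mathbf z+O(\|\mathbf z\|^3)$, and $$\mathtt H\circ\Phi_{\rm nonres}=\mathtt N+\bar{\mathtt H}_4+R,\qquad R=O(\|\mathbf z\|^6).$$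
   Context: Let $\mathtt M$ be a real symmetric positive-definite $2\times2$ matrix, $\mathtt K$ a real diagonal positive-definite $2\times 2$ matrix, and $M_3,N_3\in\mathbb R$. Let $\omega_-^2<\omega_+^2$ be the (distinct, positive) eigenvalues of $\mathtt M^{-1}\mathtt K$, with $0<\omega_-<\omega_+$, $\boldsymbol\omega:=(\omega_-,\omega_+)$, and let $\mathbf\Phi=\begin{pmatrix}\phi_1^-&\phi_1^+\\ \phi_2^-&\phi_2^+\end{pmatrix}$ be a real matrix with $\mathbf\Phi^T\mathtt M\mathbf\Phi=\mathbf I$ and $\mathbf\Phi^T\mathtt K\mathbf\Phi=\mathrm{diag}(\omega_-^2,\omega_+^2)$. Define $f(q_1,q_2)=\tfrac14M_3(\phi_1^-q_1+\phi_1^+q_2)^4+\tfrac14N_3(\phi_2^-q_1+\phi_2^+q_2)^4=\sum_{i+j=4}f_{i,j}q_1^iq_2^j$, with $f_{i,j}=\frac{6}{i!j!}\big((\phi_1^-)^i(\phi_1^+)^jM_3+(\phi_2^-)^i(\phi_2^+)^jN_3\big)$. On $\mathbb C^2\ni\mathbf z=(z_1,z_2)$ set $\mathtt N=\omega_-z_1\bar z_1+\omega_+z_2\bar z_2$ and $\mathtt G=f\big(\tfrac{z_1+\bar z_1}{\sqrt{2\omega_-}},\tfrac{z_2+\bar z_2}{\sqrt{2\omega_+}}\big)=\sum_{|\boldsymbol\alpha+\boldsymbol\beta|=4}\mathtt G_{\boldsymbol\alpha,\boldsymbol\beta}\mathbf z^{\boldsymbol\alpha}\bar{\mathbf z}^{\boldsymbol\beta}$,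 where $\mathbf z^{\boldsymbol\alpha}=z_1^{\alpha_1}z_2^{\alpha_2}$, $|\boldsymbol\alpha+\boldsymbol\beta|=\alpha_1+\alpha_2+\beta_1+\beta_2$, and $$\mathtt G_{\boldsymbol\alpha,\boldsymbol\beta}=\frac{f_{\alpha_1+\beta_1,\alpha_2+\beta_2}}{4(\sqrt{\omega_-})^{\alpha_1+\beta_1}(\sqrt{\omega_+})^{\alpha_2+\beta_2}}\frac{(\alpha_1+\beta_1)!}{\alpha_1!\beta_1!}\frac{(\alpha_2+\beta_2)!}{\alpha_2!\beta_2!}.$$ Set $\bar{\mathtt H}_4:=\sum_{|\boldsymbol\alpha|=2}\mathtt G_{\boldsymbol\alpha,\boldsymbol\alpha}|z_1|^{2\alpha_1}|z_2|^{2\alpha_2}$ and $\bar{\mathtt H}_{4,{\rm res}}:=\bar{\mathtt H}_4+\mathtt G_{(0,1),(3,0)}z_2\bar z_1^3+\mathtt G_{(3,0),(0,1)}z_1^3\bar z_2$. Poisson bracket: $\{F,G\}=\mathrm i\sum_{j=1,2}(\partial_{z_j}F\partial_{\bar z_j}G-\partial_{\bar z_j}F\partial_{z_j}G)$. Hamilton's equations of a Hamiltonian $K$ are $\dot z_j=-\mathrm i\partial_{\bar z_j}K$, $\dot{\bar z}_j=\mathrm i\partial_{z_j}K$; $\Phi^t_K$ denotes the corresponding flow. $\|\mathbf z\|:=\max\{|z_1|,|z_2|\}$. *)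

theory Defs
  imports "HOL-Analysis.Analysis"
begin

(* Points of C^2 are pairs (z1, z2) :: complex \<times> complex.
   Hamiltonians are functions C^2 \<Rightarrow> complex (all those occurring are real-valued). *)

type_synonym cpt = "complex \<times> complex"
type_synonym midx = "nat \<times> nat"

definition maxnorm :: "cpt \<Rightarrow> real" where
  "maxnorm z = max (cmod (fst z)) (cmod (snd z))"

definition dir_deriv :: "(cpt \<Rightarrow> complex) \<Rightarrow> cpt \<Rightarrow> cpt \<Rightarrow> complex" where
  "dir_deriv F z v = frechet_derivative F (at z) v"

definition wz1 :: "(cpt \<Rightarrow> complex) \<Rightarrow> cpt \<Rightarrow> complex" where
  "wz1 F z = (dir_deriv F z (1,0) - \<i> * dir_deriv F z (\<i>,0)) / 2"
definition wzb1 :: "(cpt \<Rightarrow> complex) \<Rightarrow> cpt \<Rightarrow> complex" where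
  "wzb1 F z = (dir_deriv F z (1,0) + \<i> * dir_deriv F z (\<i>,0)) / 2"
definition wz2 :: "(cpt \<Rightarrow> complex) \<Rightarrow> cpt \<Rightarrow> complex" where
  "wz2 F z = (dir_deriv F z (0,1) - \<i> * dir_deriv F z (0,\<i>)) / 2"
definition wzb2 :: "(cpt \<Rightarrow> complex) \<Rightarrow> cpt \<Rightarrow> complex" where
  "wzb2 F z = (dir_deriv F z (0,1) + \<i> * dir_deriv F z (0,\<i>)) / 2"

definition pbracket :: "(cpt \<Rightarrow> complex) \<Rightarrow> (cpt \<Rightarrow> complex) \<Rightarrow> cpt \<Rightarrow> complex" where
  "pbracket F G z = \<i> * (wz1 F z * wzb1 G z - wzb1 F z * wz1 G z
                        + wz2 F z * wzb2 G z - wzb2 F z * wz2 G z)"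

definition hamvf :: "(cpt \<Rightarrow> complex) \<Rightarrow> cpt \<Rightarrow> cpt" where
  "hamvf K z = (- \<i> * wzb1 K z, - \<i> * wzb2 K z)"

definition flow_sol :: "(cpt \<Rightarrow> complex) \<Rightarrow> cpt \<Rightarrow> (real \<Rightarrow> cpt) \<Rightarrow> bool" where
  "flow_sol K z y \<longleftrightarrow> y 0 = z \<and>
     (\<forall>t\<in>{0..1}. (y has_vector_derivative hamvf K (y t)) (at t within {0..1}))"

definition flow1 :: "(cpt \<Rightarrow> complex) \<Rightarrow> cpt \<Rightarrow> cpt" where
  "flow1 K z = (THE w. \<exists>y. flow_sol K z y \<and> y 1 = w)"

(* standard symplectic form on C^2 (up to a nonzero constant factor) *)
definition sympl :: "cpt \<Rightarrow> cpt \<Rightarrow> real" where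
  "sympl u v = Im (cnj (fst u) * fst v + cnj (snd u) * snd v)"

(* The quartic f and its coefficients f_{i,j}; Phi$1$1 = phi_1^-, Phi$1$2 = phi_1^+,
   Phi$2$1 = phi_2^-, Phi$2$2 = phi_2^+ *)
definition ffun :: "real^2^2 \<Rightarrow> real \<Rightarrow> real \<Rightarrow> real \<Rightarrow> real \<Rightarrow> real" where
  "ffun Phi M3 N3 q1 q2 =
     M3 / 4 * (Phi$1$1 * q1 + Phi$1$2 * q2) ^ 4 + N3 / 4 * (Phi$2$1 * q1 + Phi$2$2 * q2) ^ 4"

definition fcoef :: "real^2^2 \<Rightarrow> real \<Rightarrow> real \<Rightarrow> nat \<Rightarrow> nat \<Rightarrow> real" where
  "fcoef Phi M3 N3 i j = 6 / (fact i * fact j) *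
     ((Phi$1$1) ^ i * (Phi$1$2) ^ j * M3 + (Phi$2$1) ^ i * (Phi$2$2) ^ j * N3)"

definition Gcoef :: "real \<Rightarrow> real \<Rightarrow> real^2^2 \<Rightarrow> real \<Rightarrow> real \<Rightarrow> midx \<Rightarrow> midx \<Rightarrow> real" where
  "Gcoef wm wp Phi M3 N3 a b =
     fcoef Phi M3 N3 (fst a + fst b) (snd a + snd b)
       / (4 * sqrt wm ^ (fst a + fst b) * sqrt wp ^ (snd a + snd b))
     * real ((fst a + fst b) choose fst a) * real ((snd a + snd b) choose snd a)"

definition Nham :: "real \<Rightarrow> real \<Rightarrow> cpt \<Rightarrow> complex" where
  "Nham wm wp z = complex_of_real (wm * cmod (fst z) ^ 2 + wp * cmod (snd z) ^ 2)"

definition Gham :: "real \<Rightarrow> real \<Rightarrow> real^2^2 \<Rightarrow> real \<Rightarrow> real \<Rightarrow> cpt \<Rightarrow> complex" where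
  "Gham wm wp Phi M3 N3 z = complex_of_real
     (ffun Phi M3 N3 (Re (fst z + cnj (fst z)) / sqrt (2 * wm))
                     (Re (snd z + cnj (snd z)) / sqrt (2 * wp)))"

definition mono :: "midx \<Rightarrow> midx \<Rightarrow> cpt \<Rightarrow> complex" where
  "mono a b z = fst z ^ fst a * snd z ^ snd a * cnj (fst z) ^ fst b * cnj (snd z) ^ snd b"

definition idx4 :: "(midx \<times> midx) set" where
  "idx4 = {(a, b). a \<in> {..4} \<times> {..4} \<and> b \<in> {..4} \<times> {..4} \<and>
                   fst a + snd a + fst b + snd b = 4}"

definition qpoly :: "(midx \<Rightarrow> midx \<Rightarrow> complex) \<Rightarrow> cpt \<Rightarrow> complex" where
  "qpoly c z = (\<Sum>(a, b)\<in>idx4. c a b * mono a b z)"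

definition omdot :: "real \<Rightarrow> real \<Rightarrow> midx \<Rightarrow> midx \<Rightarrow> real" where
  "omdot wm wp a b = wm * (real (fst a) - real (fst b)) + wp * (real (snd a) - real (snd b))"

definition H4bar :: "real \<Rightarrow> real \<Rightarrow> real^2^2 \<Rightarrow> real \<Rightarrow> real \<Rightarrow> cpt \<Rightarrow> complex" where
  "H4bar wm wp Phi M3 N3 z =
     (\<Sum>a\<in>{a \<in> {..2} \<times> {..2}. fst a + snd a = 2}.
        complex_of_real (Gcoef wm wp Phi M3 N3 a a * cmod (fst z) ^ (2 * fst a) * cmod (snd z) ^ (2 * snd a)))"

definition H4res :: "real \<Rightarrow> real \<Rightarrow> real^2^2 \<Rightarrow> real \<Rightarrow> real \<Rightarrow> cpt \<Rightarrow> complex" where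
  "H4res wm wp Phi M3 N3 z = H4bar wm wp Phi M3 N3 z
     + complex_of_real (Gcoef wm wp Phi M3 N3 (0,1) (3,0)) * snd z * cnj (fst z) ^ 3
     + complex_of_real (Gcoef wm wp Phi M3 N3 (3,0) (0,1)) * fst z ^ 3 * cnj (snd z)"

definition Sres_coef :: "real \<Rightarrow> real \<Rightarrow> real^2^2 \<Rightarrow> real \<Rightarrow> real \<Rightarrow> midx \<Rightarrow> midx \<Rightarrow> complex" where
  "Sres_coef wm wp Phi M3 N3 a b =
     (if a \<noteq> b \<and> (a, b) \<notin> {((3,0),(0,1)), ((0,1),(3,0))}
      then \<i> * complex_of_real (Gcoef wm wp Phi M3 N3 a b / omdot wm wp a b) else 0)"

definition S_coef :: "real \<Rightarrow> real \<Rightarrow> real^2^2 \<Rightarrow> real \<Rightarrow> real \<Rightarrow> midx \<Rightarrow> midx \<Rightarrow> complex" where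
  "S_coef wm wp Phi M3 N3 a b =
     (if a \<noteq> b then \<i> * complex_of_real (Gcoef wm wp Phi M3 N3 a b / omdot wm wp a b) else 0)"

end

theory Submission
  imports Defs
begin

text \<open>
  The generator \<open>S\<close> is a real homogeneous quartic, so its Hamiltonian field is cubic and has Lipschitz
  constant at most 1/2 on a small ball. There the time-one flow exists by a single contraction on
  \<open>[0,1]\<close>, its derivative solves the variational equation, and \<open>sympl\<close> is constant along pairs of
  variations because the second derivative of \<open>S\<close> is symmetric. Along the flow \<open>dF/dt = {S, F}\<close>, and
  bracketing with \<open>S\<close> raises the degree by two: hence \<open>N\<close> changes by \<open>{S, N}\<close> and \<open>G\<close> by nothing, both
  up to order six, and the homological equation \<open>G + {S, N} = Z\<close> gives the normal form. That equation is
  diagonal on monomials, with divisors \<open>\<omega> \<cdot> (\<alpha> - \<beta>)\<close> that can vanish off the diagonal only at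
  \<open>\<alpha> - \<beta> = \<plusminus>(3,-1)\<close>.
\<close>

section \<open>Ordinary differential equations on the unit interval\<close>

definition ode_sol :: "(real \<Rightarrow> 'a \<Rightarrow> 'a::real_normed_vector) \<Rightarrow> 'a \<Rightarrow> (real \<Rightarrow> 'a) \<Rightarrow> bool" where
  "ode_sol f z y \<longleftrightarrow> y 0 = z \<and>
     (\<forall>t\<in>{0..1}. (y has_vector_derivative f t (y t)) (at t within {0..1}))"

lemma ode_sol_continuous: "ode_sol f z y \<Longrightarrow> continuous_on {0..1} y"
  unfolding ode_sol_def by (rule continuous_on_vector_derivative) blast

text \<open>On an interval of length 1 a Lipschitz constant below 1 makes the Picard operator itself
  a sup norm contraction, so one fixed point covers all of [0,1]. Continuity is asked for along
  curves, a form that suits both an autonomous field and the variational equation.\<close>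

lemma picard_contraction:
  fixes f :: "real \<Rightarrow> 'a::banach \<Rightarrow> 'a"
  assumes cont: "\<And>y. continuous_on {0..1} y \<Longrightarrow> continuous_on {0..1} (\<lambda>t. f t (y t))"
    and lip: "\<And>t x y. t \<in> {0..1} \<Longrightarrow> norm (f t x - f t y) \<le> L * norm (x - y)"
    and L: "0 \<le> L" "L < 1"
  shows "\<exists>y. ode_sol f z y"
proof -
  have bc: "continuous_on {0..1} (apply_bcontfun (y :: real \<Rightarrow>\<^sub>C 'a))" for y
    using apply_bcontfun[of y] by (auto simp: bcontfun_def intro: continuous_on_subset)
  have cf: "continuous_on {0..1} (\<lambda>t. f t (apply_bcontfun y t))" for y
    by (rule cont[OF bc])
  define T0 where "T0 y t = z + integral {0..t} (\<lambda>s. f s (apply_bcontfun y s))" for y t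
  have T0d: "(T0 y has_vector_derivative f t (apply_bcontfun y t)) (at t within {0..1})"
    if "t \<in> {0..1}" for y t
    unfolding T0_def using integral_has_vector_derivative[OF cf that, of y]
    by (auto intro!: derivative_eq_intros)
  have T0c: "continuous_on (cbox (0::real) 1) (T0 y)" for y
    unfolding cbox_interval by (rule continuous_on_vector_derivative[OF T0d])
  \<comment> \<open>Banach's theorem is applied in the complete space of bounded continuous
    functions on the whole line; precomposing with \<open>clamp 0 1\<close> extends the Picard
    iterate to that space.\<close>
  have "\<exists>g::real \<Rightarrow>\<^sub>C 'a. \<forall>x. apply_bcontfun g x = T0 y (clamp 0 1 x)" for y
    by (rule continuous_on_cbox_bcontfunE[OF T0c[of y]]) auto
  then obtain T where T: "\<And>y x. apply_bcontfun (T y) x = T0 y (clamp 0 1 x)" by metis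
  have "dist (T y) (T w) \<le> L * dist y w" for y w
  proof (rule dist_bound)
    fix x :: real
    define t where "t = clamp 0 1 x"
    have t: "t \<in> {0..1}" using clamp_in_interval[of 0 "1::real" x] by (auto simp: t_def)
    have i: "(\<lambda>s. f s (apply_bcontfun y s)) integrable_on {0..t}" for y
      by (rule integrable_continuous_real, rule continuous_on_subset[OF cf]) (use t in auto)
    have "norm (integral {0..t} (\<lambda>s. f s (apply_bcontfun y s) - f s (apply_bcontfun w s)))
       \<le> integral {0..t} (\<lambda>s. L * dist y w)"
    proof (rule integral_norm_bound_integral)
      show "(\<lambda>s. f s (apply_bcontfun y s) - f s (apply_bcontfun w s)) integrable_on {0..t}"
        by (intro integrable_diff i)
      fix s assume "s \<in> {0..t}"
      then have "norm (f s (apply_bcontfun y s) - f s (apply_bcontfun w s))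
        \<le> L * norm (apply_bcontfun y s - apply_bcontfun w s)"
        by (intro lip) (use t in auto)
      also have "\<dots> \<le> L * dist y w"
        using dist_bounded[of y s w] L by (auto simp: dist_norm intro: mult_left_mono)
      finally show "norm (f s (apply_bcontfun y s) - f s (apply_bcontfun w s)) \<le> L * dist y w" .
    qed auto
    also have "\<dots> = t * (L * dist y w)"
      using t by simp
    also have "\<dots> \<le> L * dist y w"
      using t L by (intro mult_left_le_one_le mult_nonneg_nonneg) auto
    finally show "dist (apply_bcontfun (T y) x) (apply_bcontfun (T w) x) \<le> L * dist y w"
      unfolding T T0_def t_def[symmetric] by (simp add: dist_norm integral_diff i)
  qed
  then obtain y where y: "T y = y"
    using banach_fix_type[OF L, of T] by auto
  have eq: "apply_bcontfun y t = T0 y t" if "t \<in> {0..1}" for t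
    using T[of y t] that unfolding y by (simp add: clamp_cancel_cbox)
  have "ode_sol f z (apply_bcontfun y)"
    unfolding ode_sol_def
  proof (intro conjI ballI)
    show "apply_bcontfun y 0 = z" by (subst eq) (auto simp: T0_def)
    show "(apply_bcontfun y has_vector_derivative f t (apply_bcontfun y t)) (at t within {0..1})"
      if "t \<in> {0..1}" for t
      by (rule has_vector_derivative_transform[OF that _ T0d[OF that]]) (simp add: eq)
  qed
  then show ?thesis by blast
qed

lemma vector_derivative_bound_unit:
  fixes g :: "real \<Rightarrow> 'a::real_normed_vector"
  assumes "\<And>t. t \<in> {0..1} \<Longrightarrow> (g has_vector_derivative g' t) (at t within {0..1})"
    and "\<And>t. t \<in> {0..1} \<Longrightarrow> norm (g' t) \<le> B"
    and "s \<in> {0..1}" "t \<in> {0..1}"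
  shows "norm (g t - g s) \<le> B"
proof -
  have "norm (g t - g s) \<le> B * norm (t - s)"
  proof (rule differentiable_bound)
    show "(g has_derivative (\<lambda>h. h *\<^sub>R g' x)) (at x within {0..1})" if "x \<in> {0..1}" for x
      using assms(1)[OF that] by (simp add: has_vector_derivative_def)
    show "onorm (\<lambda>h. h *\<^sub>R g' x) \<le> B" if "x \<in> {0..1}" for x
      by (rule onorm_le) (use assms(2)[OF that] in \<open>auto simp: mult.commute[of B] intro!: mult_left_mono\<close>)
  qed (use assms in auto)
  also have "\<dots> \<le> B"
    using assms(3,4) norm_ge_zero[THEN order_trans, OF assms(2)[OF assms(3)]]
    by (auto intro!: mult_right_le_one_le)
  finally show ?thesis .
qed

text \<open>At the point \<open>m\<close> where the norm of \<open>d\<close> is largest, the mean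
  value inequality gives max <= norm (d s) + max/2 + c, and half of the maximum is absorbed. The
  base point \<open>s\<close> is free, so the bound also runs backwards in time.\<close>

lemma slow_growth:
  fixes d :: "real \<Rightarrow> 'a::real_normed_vector"
  assumes der: "\<And>t. t \<in> {0..1} \<Longrightarrow> (d has_vector_derivative d' t) (at t within {0..1})"
    and bnd: "\<And>t. t \<in> {0..1} \<Longrightarrow> norm (d' t) \<le> 1/2 * norm (d t) + c"
    and s: "s \<in> {0..1}" and t: "t \<in> {0..1}"
  shows "norm (d t) \<le> 2 * (norm (d s) + c)"
proof -
  have "continuous_on {0..1} (\<lambda>x. norm (d x))"
    by (intro continuous_on_norm continuous_on_vector_derivative[OF der])
  then obtain m where m: "m \<in> {0..1}" "\<And>x. x \<in> {0..1} \<Longrightarrow> norm (d x) \<le> norm (d m)"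
    using continuous_attains_sup[of "{0..1::real}" "\<lambda>x. norm (d x)"] by fastforce
  have "norm (d m - d s) \<le> 1/2 * norm (d m) + c"
  proof (rule vector_derivative_bound_unit[OF der _ s m(1)])
    show "norm (d' x) \<le> 1/2 * norm (d m) + c" if "x \<in> {0..1}" for x
      using bnd[OF that] m(2)[OF that] by linarith
  qed auto
  moreover have "norm (d m) - norm (d s) \<le> norm (d m - d s)" by (rule norm_triangle_ineq2)
  moreover note m(2)[OF t]
  ultimately show ?thesis by argo
qed

text \<open>The weighted square exp(-2 L t) |d t|^2 is nonincreasing. In contrast to
  \<open>slow_growth\<close>, \<open>L\<close> may be large.\<close>

lemma gronwall_zero:
  fixes d :: "real \<Rightarrow> 'a::real_inner"
  assumes der: "\<And>t. t \<in> {0..1} \<Longrightarrow> (d has_vector_derivative d' t) (at t within {0..1})"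
    and bnd: "\<And>t. t \<in> {0..1} \<Longrightarrow> norm (d' t) \<le> L * norm (d t)"
    and "d 0 = 0" and t: "t \<in> {0..1}"
  shows "d t = 0"
proof -
  define g where "g t = exp (- 2 * L * t) * (d t \<bullet> d t)" for t
  have cd: "continuous_on {0..1} d"
    by (rule continuous_on_vector_derivative[OF der])
  have "g 0 \<ge> g t"
  proof (rule DERIV_nonpos_imp_decreasing_open[where f = g and a = 0 and b = t])
    show "0 \<le> t" using t by simp
    show "continuous_on {0..t} g" unfolding g_def
      by (intro continuous_intros continuous_on_subset[OF cd]) (use t in auto)
    fix x assume x: "0 < x" "x < t"
    then have "(d has_vector_derivative d' x) (at x within {0<..<1})"
      using der[of x] t by (auto intro: has_vector_derivative_within_subset)
    then have "(d has_derivative (\<lambda>h. h *\<^sub>R d' x)) (at x)"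
      using x t by (subst (asm) at_within_open) (auto simp: has_vector_derivative_def)
    then have "(g has_derivative (\<lambda>h. exp (- 2 * L * x) * (2 * (d x \<bullet> d' x) - 2 * L * (d x \<bullet> d x)) * h)) (at x)"
      unfolding g_def
      by (auto intro!: derivative_eq_intros simp: fun_eq_iff inner_commute algebra_simps)
    then have "DERIV g x :> exp (- 2 * L * x) * (2 * (d x \<bullet> d' x) - 2 * L * (d x \<bullet> d x))"
      by (simp add: has_field_derivative_def)
    moreover have "d x \<bullet> d' x \<le> L * (d x \<bullet> d x)"
    proof -
      have "d x \<bullet> d' x \<le> norm (d x) * norm (d' x)" by (rule norm_cauchy_schwarz)
      also have "\<dots> \<le> norm (d x) * (L * norm (d x))"
        using bnd[of x] x t by (auto intro!: mult_left_mono)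
      finally show ?thesis by (simp add: dot_square_norm power2_eq_square algebra_simps)
    qed
    ultimately show "\<exists>y. DERIV g x :> y \<and> y \<le> 0"
      by (intro exI[of _ "exp (- 2 * L * x) * (2 * (d x \<bullet> d' x) - 2 * L * (d x \<bullet> d x))"])
        (auto simp: mult_le_0_iff)
  qed
  then have "exp (- 2 * L * t) * (d t \<bullet> d t) \<le> 0" by (simp add: g_def assms(3))
  then have "norm (d t) ^ 2 \<le> 0"
    by (simp add: mult_le_0_iff dot_square_norm)
  then show ?thesis by simp
qed

section \<open>The time-one map of a cubic vector field\<close>

definition time_one :: "('a \<Rightarrow> 'a::real_normed_vector) \<Rightarrow> 'a \<Rightarrow> 'a" where
  "time_one X z = (THE w. \<exists>y. ode_sol (\<lambda>_. X) z y \<and> y 1 = w)"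

text \<open>What is kept of a homogeneous cubic field is its growth: a derivative of quadratic size
  with the matching difference bound. \<open>D_cont\<close>, stated for each fixed direction, makes
  the variational equation continuous in time.\<close>

locale cubic_field =
  fixes X :: "'a::euclidean_space \<Rightarrow> 'a" and DX :: "'a \<Rightarrow> 'a \<Rightarrow> 'a" and K :: real
  assumes der: "(X has_derivative DX x) (at x)"
    and zero: "X 0 = 0"
    and K_pos: "K > 0"
    and D_bound: "norm (DX x v) \<le> K * norm x ^ 2 * norm v"
    and D_lip: "norm (DX x v - DX y v) \<le> K * (norm x + norm y) * norm (x - y) * norm v"
    and D_cont: "continuous_on UNIV (\<lambda>x. DX x v)"
begin

lemma D_bounded_linear: "bounded_linear (DX x)"
  using der by (rule has_derivative_bounded_linear)

lemma lipschitz_ball: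
  assumes "norm x \<le> R" "norm y \<le> R"
  shows "norm (X x - X y) \<le> K * R ^ 2 * norm (x - y)"
proof (rule differentiable_bound[of "cball 0 R"])
  show "(X has_derivative DX u) (at u within cball 0 R)" for u
    using der by (rule has_derivative_at_withinI)
  show "onorm (DX u) \<le> K * R ^ 2" if "u \<in> cball 0 R" for u
  proof (rule onorm_le)
    fix v :: 'a
    have "norm u ^ 2 \<le> R ^ 2" using that by (intro power_mono) auto
    then have "K * norm u ^ 2 * norm v \<le> K * R ^ 2 * norm v"
      using K_pos by (intro mult_right_mono mult_left_mono) auto
    then show "norm (DX u v) \<le> K * R ^ 2 * norm v"
      using D_bound[of u v] by linarith
  qed
qed (use assms in auto)

lemma norm_le: "norm (X x) \<le> K * norm x ^ 3"
  using lipschitz_ball[of x "norm x" 0] zero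
  by (simp add: power2_eq_square power3_eq_cube mult.assoc)

lemma continuous: "continuous_on UNIV X"
  by (intro continuous_at_imp_continuous_on ballI has_derivative_continuous[OF der])

text \<open>On the segment from \<open>x\<close> to \<open>y\<close> the derivative moves by at most
  2 K R |y - x|, by \<open>D_lip\<close>, so the mean value inequality for X - DX x leaves a
  quadratic error.\<close>

lemma linearization_error:
  assumes "norm x \<le> R" "norm y \<le> R"
  shows "norm (X y - X x - DX x (y - x)) \<le> 2 * K * R * norm (y - x) ^ 2"
proof -
  define S where "S = {x + t *\<^sub>R (y - x) | t. t \<in> {0..1}}"
  have "norm (X y - X x - DX x (y - x)) \<le> norm (y - x) * (2 * K * R * norm (y - x))"
  proof (rule differentiable_bound_linearization[where S = S and f' = DX and ?x0.0 = x])
    show "x + t *\<^sub>R (y - x) \<in> S" if "t \<in> {0..1}" for t using that by (auto simp: S_def)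
    show "(X has_derivative DX u) (at u within S)" for u
      using der by (rule has_derivative_at_withinI)
    show "x \<in> S" unfolding S_def by (intro CollectI exI[of _ 0]) auto
    fix u assume "u \<in> S"
    then obtain t where t: "t \<in> {0..1}" "u = x + t *\<^sub>R (y - x)" by (auto simp: S_def)
    have "u = (1 - t) *\<^sub>R x + t *\<^sub>R y" by (simp add: t algebra_simps)
    then have "u \<in> cball 0 R"
      using convexD_alt[OF convex_cball, of x 0 R y t] assms t by auto
    then have u: "norm u \<le> R" by simp
    have ux: "norm (u - x) \<le> norm (y - x)" using t by (auto intro!: mult_left_le_one_le)
    have "norm ((DX u - DX x) v) \<le> 2 * K * R * norm (y - x) * norm v" for v
    proof -
      have "norm (DX u v - DX x v) \<le> K * (norm u + norm x) * norm (u - x) * norm v"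
        by (rule D_lip)
      also have "\<dots> \<le> K * (2 * R) * norm (y - x) * norm v"
        using u ux assms K_pos order_trans[OF norm_ge_zero u]
        by (intro mult_mono order_refl) auto
      finally show ?thesis by simp
    qed
    then show "onorm (DX u - DX x) \<le> 2 * K * R * norm (y - x)" by (rule onorm_le)
  qed
  then show ?thesis by (simp add: power2_eq_square mult_ac)
qed

text \<open>Chosen so that K rho^2 = 1/2: this is a Lipschitz constant on the ball of radius
  \<open>rho\<close>, and the rate that \<open>slow_growth\<close> absorbs.\<close>

definition rho :: real where "rho = 1 / sqrt (2 * K)"

lemma rho_pos: "rho > 0" using K_pos by (simp add: rho_def)

lemma K_rho: "K * rho ^ 2 = 1 / 2"
  using K_pos by (simp add: rho_def power_divide)

lemma lipschitz_rho:
  "norm x \<le> rho \<Longrightarrow> norm y \<le> rho \<Longrightarrow> norm (X x - X y) \<le> 1/2 * norm (x - y)"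
  using lipschitz_ball[of x rho y] K_rho by simp

lemma D_bound_rho: "norm x \<le> rho \<Longrightarrow> norm (DX x v) \<le> 1/2 * norm v"
proof -
  assume "norm x \<le> rho"
  then have "norm x ^ 2 \<le> rho ^ 2" by (intro power_mono) auto
  then have "K * norm x ^ 2 * norm v \<le> K * rho ^ 2 * norm v"
    using K_pos by (intro mult_right_mono mult_left_mono) auto
  then show ?thesis using D_bound[of x v] K_rho by simp
qed

text \<open>The field is cut off by the projection onto the ball of radius \<open>rho\<close>, which makes it
  globally Lipschitz with constant 1/2; small solutions never see the cutoff.\<close>

lemma solution_exists:
  assumes z: "norm z \<le> rho / 2"
  shows "\<exists>y. ode_sol (\<lambda>_. X) z y \<and> (\<forall>t\<in>{0..1}. norm (y t) \<le> 2 * norm z)"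
proof -
  let ?P = "closest_point (cball (0::'a) rho)"
  have P: "norm (?P x) \<le> rho" for x
    using closest_point_in_set[of "cball (0::'a) rho" x] rho_pos by auto
  have Plip: "norm (?P x - ?P y) \<le> norm (x - y)" for x y
    using closest_point_lipschitz[of "cball (0::'a) rho" x y] rho_pos by (simp add: dist_norm)
  have P0: "?P x = x" if "norm x \<le> rho" for x
    using that by (intro closest_point_self) auto
  have lip: "norm (X (?P x) - X (?P y)) \<le> 1/2 * norm (x - y)" for x y
    using lipschitz_rho[OF P P, of x y] Plip[of x y] by linarith
  have "\<exists>y. ode_sol (\<lambda>_ x. X (?P x)) z y"
  proof (rule picard_contraction[where L = "1/2"])
    have "continuous_on UNIV ?P"
      using rho_pos by (intro continuous_on_closest_point) auto
    then have "continuous_on UNIV (\<lambda>x. X (?P x))"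
      by (intro continuous_on_compose2[OF continuous]) auto
    then show "continuous_on {0..1} (\<lambda>t. X (?P (y t)))" if "continuous_on {0..1} y" for y :: "real \<Rightarrow> 'a"
      using that by (intro continuous_on_compose2[where g = "\<lambda>x. X (?P x)" and f = y]) auto
  qed (use lip in auto)
  then obtain y where y: "ode_sol (\<lambda>_ x. X (?P x)) z y" by blast
  have small: "norm (y t) \<le> 2 * norm z" if t: "t \<in> {0..1}" for t
  proof -
    have "norm (y t) \<le> 2 * (norm (y 0) + 0)"
    proof (rule slow_growth[OF _ _ _ t])
      show "(y has_vector_derivative X (?P (y t))) (at t within {0..1})" if "t \<in> {0..1}" for t
        using y that by (simp add: ode_sol_def)
      show "norm (X (?P (y t))) \<le> 1/2 * norm (y t) + 0" for t
        using lip[of "y t" 0] P0[of 0] rho_pos zero by simp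
    qed auto
    then show ?thesis using y by (simp add: ode_sol_def)
  qed
  have "X (?P (y t)) = X (y t)" if "t \<in> {0..1}" for t
    using small[OF that] z by (subst P0) auto
  then have "ode_sol (\<lambda>_. X) z y"
    using y by (simp add: ode_sol_def)
  with small show ?thesis by blast
qed

text \<open>The competing solutions may leave the small ball, since \<open>time_one\<close>
  quantifies over all of them. Both are bounded on the compact interval, and on a ball containing
  them the field has some Lipschitz constant, however large.\<close>

lemma solution_unique:
  assumes "ode_sol (\<lambda>_. X) z y" "ode_sol (\<lambda>_. X) z w" "t \<in> {0..1}"
  shows "y t = w t"
proof -
  have "bounded (y ` {0..1} \<union> w ` {0..1})"
    using ode_sol_continuous[OF assms(1)] ode_sol_continuous[OF assms(2)]
    by (auto intro!: compact_imp_bounded compact_continuous_image)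
  then obtain R where R: "\<And>x. x \<in> y ` {0..1} \<union> w ` {0..1} \<Longrightarrow> norm x \<le> R"
    by (auto simp: bounded_iff)
  have "y t - w t = 0"
  proof (rule gronwall_zero[OF _ _ _ assms(3)])
    show "((\<lambda>t. y t - w t) has_vector_derivative X (y t) - X (w t)) (at t within {0..1})"
      if "t \<in> {0..1}" for t
      using assms(1,2) that by (auto simp: ode_sol_def intro: has_vector_derivative_diff)
    show "norm (X (y t) - X (w t)) \<le> K * R ^ 2 * norm (y t - w t)" if "t \<in> {0..1}" for t
      by (rule lipschitz_ball) (use R that in auto)
  qed (use assms in \<open>auto simp: ode_sol_def\<close>)
  then show ?thesis by simp
qed

lemma time_one_eq:
  assumes "ode_sol (\<lambda>_. X) z y"
  shows "time_one X z = y 1"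
  unfolding time_one_def
proof (rule the_equality)
  show "\<exists>w. ode_sol (\<lambda>_. X) z w \<and> w 1 = y 1" using assms by blast
  show "v = y 1" if "\<exists>w. ode_sol (\<lambda>_. X) z w \<and> w 1 = v" for v
    using that solution_unique[OF _ assms, of _ 1] by force
qed

text \<open>This is \<open>slow_growth\<close> based at time 1: orbits that agree there agree at
  time 0.\<close>

lemma time_one_inj: "inj_on (time_one X) {z. norm z \<le> rho / 2}"
proof (rule inj_onI, clarsimp)
  fix z w :: 'a assume z: "norm z * 2 \<le> rho" and w: "norm w * 2 \<le> rho"
    and eq: "time_one X z = time_one X w"
  obtain y where y: "ode_sol (\<lambda>_. X) z y" "\<And>t. t\<in>{0..1} \<Longrightarrow> norm (y t) \<le> 2 * norm z"
    using solution_exists[of z] z by auto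
  obtain v where v: "ode_sol (\<lambda>_. X) w v" "\<And>t. t\<in>{0..1} \<Longrightarrow> norm (v t) \<le> 2 * norm w"
    using solution_exists[of w] w by auto
  have "norm (y 0 - v 0) \<le> 2 * (norm (y 1 - v 1) + 0)"
  proof (rule slow_growth)
    show "((\<lambda>t. y t - v t) has_vector_derivative X (y t) - X (v t)) (at t within {0..1})"
      if "t \<in> {0..1}" for t
      using y(1) v(1) that by (auto simp: ode_sol_def intro: has_vector_derivative_diff)
    show "norm (X (y t) - X (v t)) \<le> 1 / 2 * norm (y t - v t) + 0" if "t \<in> {0..1}" for t
      using lipschitz_rho[of "y t" "v t"] y(2)[OF that] v(2)[OF that] z w by linarith
  qed auto
  moreover have "y 1 = v 1" using eq time_one_eq y(1) v(1) by simp
  ultimately show "z = w" using y(1) v(1) by (simp add: ode_sol_def)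
qed

text \<open>The derivative sends \<open>u\<close> to \<open>V u 1\<close>, where \<open>V u\<close>
  is the variation along the orbit of \<open>z\<close> that starts at \<open>u\<close>. By
  \<open>inv\<close> the time derivative of \<open>\<sigma>\<close> on two variations
  vanishes.\<close>

lemma time_one_derivative:
  fixes \<sigma> :: "'a \<Rightarrow> 'a \<Rightarrow> real"
  assumes z: "norm z < rho / 2"
    and \<sigma>: "bounded_bilinear \<sigma>"
    and inv: "\<And>x u v. \<sigma> (DX x u) v + \<sigma> u (DX x v) = 0"
  shows "\<exists>D. (time_one X has_derivative D) (at z) \<and> (\<forall>u v. \<sigma> (D u) (D v) = \<sigma> u v)"
proof -
  obtain y where y: "ode_sol (\<lambda>_. X) z y" "\<And>t. t\<in>{0..1} \<Longrightarrow> norm (y t) \<le> 2 * norm z"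
    using solution_exists[of z] z by auto
  have yr: "norm (y t) \<le> rho" if "t \<in> {0..1}" for t using y(2)[OF that] z by linarith
  interpret D: bounded_linear "DX x" for x by (rule D_bounded_linear)
  interpret \<sigma>: bounded_bilinear \<sigma> by (rule \<sigma>)
  have "\<exists>v. ode_sol (\<lambda>t. DX (y t)) u v" for u
  proof -
    let ?f = "\<lambda>t. DX (y (clamp 0 1 t))"
    have "\<exists>v. ode_sol ?f u v"
    proof (rule picard_contraction[where L = "1/2"])
      fix w :: "real \<Rightarrow> 'a" assume w: "continuous_on {0..1} w"
      \<comment> \<open>A basis expansion of \<open>v\<close> reduces continuity in two moving
        arguments to \<open>D_cont\<close>.\<close>
      have eq: "DX x v = (\<Sum>b\<in>Basis. (v \<bullet> b) *\<^sub>R DX x b)" for x v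
        by (subst euclidean_representation[of v, symmetric])
          (simp only: D.sum D.scaleR)
      have "continuous_on {0..1} (\<lambda>t. DX (y t) b)" for b
        by (rule continuous_on_compose2[OF D_cont[of b] ode_sol_continuous[OF y(1)]]) auto
      then have "continuous_on {0..1} (\<lambda>t. \<Sum>b\<in>Basis. (w t \<bullet> b) *\<^sub>R DX (y t) b)"
        by (intro continuous_intros w)
      then have "continuous_on {0..1} (\<lambda>t. DX (y t) (w t))"
        by (subst eq)
      then show "continuous_on {0..1} (\<lambda>t. ?f t (w t))"
        by (rule continuous_on_eq) simp
    next
      fix t :: real and a b :: 'a assume "t \<in> {0..1}"
      then show "norm (?f t a - ?f t b) \<le> 1/2 * norm (a - b)"
        using D_bound_rho[OF yr, of t "a - b"] by (simp add: D.diff)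
    qed auto
    then show ?thesis by (simp add: ode_sol_def)
  qed
  then obtain V where V: "\<And>u. ode_sol (\<lambda>t. DX (y t)) u (V u)" by metis
  have V0: "V u 0 = u" for u using V[of u] by (simp add: ode_sol_def)
  have Vd: "(V u has_vector_derivative DX (y t) (V u t)) (at t within {0..1})"
    if "t \<in> {0..1}" for u t using V[of u] that by (simp add: ode_sol_def)
  \<comment> \<open>Applied below to the additivity and homogeneity defects of \<open>V\<close>,
    which solve the same linear equation from 0.\<close>
  have uniq: "d 1 = 0" if d: "ode_sol (\<lambda>t. DX (y t)) 0 d" for d
  proof (rule gronwall_zero[where d' = "\<lambda>t. DX (y t) (d t)" and L = "1/2"])
    show "norm (DX (y t) (d t)) \<le> 1/2 * norm (d t)" if "t \<in> {0..1}" for t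
      by (rule D_bound_rho[OF yr[OF that]])
  qed (use d in \<open>auto simp: ode_sol_def\<close>)
  have lin: "linear (\<lambda>u. V u 1)"
  proof (rule linearI)
    fix a b :: 'a
    have "ode_sol (\<lambda>t. DX (y t)) 0 (\<lambda>t. V (a + b) t - (V a t + V b t))"
      unfolding ode_sol_def
      by (auto simp: V0 D.diff D.add intro!: has_vector_derivative_diff has_vector_derivative_add Vd)
    from uniq[OF this]
    show "V (a + b) 1 = V a 1 + V b 1" by simp
  next
    fix r :: real and a :: 'a
    have "ode_sol (\<lambda>t. DX (y t)) 0 (\<lambda>t. V (r *\<^sub>R a) t - r *\<^sub>R V a t)"
      unfolding ode_sol_def
      by (auto simp: V0 D.diff D.scaleR
          intro!: has_vector_derivative_diff bounded_linear.has_vector_derivative[OF bounded_linear_scaleR_right] Vd)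
    from uniq[OF this]
    show "V (r *\<^sub>R a) 1 = r *\<^sub>R V a 1" by simp
  qed
  have "(time_one X has_derivative (\<lambda>u. V u 1)) (at z)"
    unfolding has_derivative_at_alt
  proof (intro conjI allI impI)
    show "bounded_linear (\<lambda>u. V u 1)" using lin by (simp add: linear_conv_bounded_linear)
    fix e :: real assume e: "e > 0"
    \<comment> \<open>The first bound keeps \<open>x\<close> in the ball where orbits exist and stay
      small; the second makes the final error \<open>2 * c\<close>, which is 16 K rho |x - z|^2, at
      most \<open>e * norm (x - z)\<close>.\<close>
    define d where "d = min (rho / 2 - norm z) (e / (16 * K * rho))"
    have "d > 0" using e z K_pos rho_pos by (simp add: d_def)
    moreover have "norm (time_one X x - time_one X z - V (x - z) 1) \<le> e * norm (x - z)"
      if x: "norm (x - z) < d" for x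
    proof -
      have nx: "norm x < rho / 2" using x norm_triangle_ineq2[of x z] by (simp add: d_def)
      obtain w where w: "ode_sol (\<lambda>_. X) x w" "\<And>t. t\<in>{0..1} \<Longrightarrow> norm (w t) \<le> 2 * norm x"
        using solution_exists[of x] nx by auto
      have wr: "norm (w t) \<le> rho" if "t \<in> {0..1}" for t using w(2)[OF that] nx by linarith
      have wd: "(w has_vector_derivative X (w t)) (at t within {0..1})"
        and yd: "(y has_vector_derivative X (y t)) (at t within {0..1})" if "t \<in> {0..1}" for t
        using w(1) y(1) that by (auto simp: ode_sol_def)
      have dist: "norm (w t - y t) \<le> 2 * (norm (w 0 - y 0) + 0)" if t: "t \<in> {0..1}" for t
      proof (rule slow_growth[OF has_vector_derivative_diff[OF wd yd] _ _ t])
        show "norm (X (w t) - X (y t)) \<le> 1/2 * norm (w t - y t) + 0" if "t \<in> {0..1}" for t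
          using lipschitz_rho[OF wr yr, of t t] that by simp
      qed auto
      have dist: "norm (w t - y t) \<le> 2 * norm (x - z)" if t: "t \<in> {0..1}" for t
        using dist[OF t] w(1) y(1) by (simp add: ode_sol_def)
      \<comment> \<open>The value of \<open>linearization_error\<close> at radius \<open>rho\<close>
        for points at distance at most \<open>2 * norm (x - z)\<close>.\<close>
      define c where "c = 8 * K * rho * norm (x - z) ^ 2"
      have "norm (w 1 - y 1 - V (x - z) 1) \<le> 2 * (norm (w 0 - y 0 - V (x - z) 0) + c)"
      proof (rule slow_growth[where d = "\<lambda>t. w t - y t - V (x - z) t"])
        show "((\<lambda>t. w t - y t - V (x - z) t) has_vector_derivative
               X (w t) - X (y t) - DX (y t) (V (x - z) t)) (at t within {0..1})" if "t \<in> {0..1}" for t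
          by (intro has_vector_derivative_diff wd yd Vd that)
        fix t :: real assume t: "t \<in> {0..1}"
        have "norm (X (w t) - X (y t) - DX (y t) (w t - y t)) \<le> 2 * K * rho * norm (w t - y t) ^ 2"
          by (rule linearization_error[OF yr wr]) (use t in auto)
        also have "\<dots> \<le> 2 * K * rho * (2 * norm (x - z)) ^ 2"
          using K_pos rho_pos by (intro mult_left_mono power_mono dist t) auto
        finally have 1: "norm (X (w t) - X (y t) - DX (y t) (w t - y t)) \<le> c"
          by (simp add: c_def power_mult_distrib)
        \<comment> \<open>The defect of the linear prediction obeys the variational equation up to
          the linearization error; the linear part has norm at most 1/2, so
          \<open>slow_growth\<close> applies.\<close>
        have "X (w t) - X (y t) - DX (y t) (V (x - z) t)
           = (X (w t) - X (y t) - DX (y t) (w t - y t)) + DX (y t) (w t - y t - V (x - z) t)"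
          by (simp add: D.diff)
        also have "norm \<dots> \<le> c + 1/2 * norm (w t - y t - V (x - z) t)"
          by (intro norm_triangle_mono 1 D_bound_rho yr t)
        finally show "norm (X (w t) - X (y t) - DX (y t) (V (x - z) t))
          \<le> 1/2 * norm (w t - y t - V (x - z) t) + c" by simp
      qed auto
      then have "norm (time_one X x - time_one X z - V (x - z) 1) \<le> 2 * c"
        using w(1) y(1) time_one_eq[OF w(1)] time_one_eq[OF y(1)] by (simp add: V0 ode_sol_def)
      also have "\<dots> = (16 * K * rho * norm (x - z)) * norm (x - z)"
        by (simp add: c_def power2_eq_square)
      also have "\<dots> \<le> e * norm (x - z)"
      proof (rule mult_right_mono)
        have "norm (x - z) \<le> e / (16 * K * rho)" using x by (simp add: d_def)
        then show "16 * K * rho * norm (x - z) \<le> e"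
          using K_pos rho_pos by (simp add: field_simps)
      qed simp
      finally show ?thesis .
    qed
    ultimately show "\<exists>d>0. \<forall>x. norm (x - z) < d \<longrightarrow>
        norm (time_one X x - time_one X z - V (x - z) 1) \<le> e * norm (x - z)" by blast
  qed
  moreover have "\<sigma> (V u 1) (V v 1) = \<sigma> u v" for u v
  proof -
    have "norm (\<sigma> (V u 1) (V v 1) - \<sigma> (V u 0) (V v 0)) \<le> 0"
    proof (rule vector_derivative_bound_unit[where g = "\<lambda>t. \<sigma> (V u t) (V v t)"])
      fix t :: real assume t: "t \<in> {0..1}"
      have "((\<lambda>t. \<sigma> (V u t) (V v t)) has_vector_derivative
         \<sigma> (V u t) (DX (y t) (V v t)) + \<sigma> (DX (y t) (V u t)) (V v t)) (at t within {0..1})"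
        by (rule \<sigma>.has_vector_derivative[OF Vd Vd]) (use t in auto)
      then show "((\<lambda>t. \<sigma> (V u t) (V v t)) has_vector_derivative 0) (at t within {0..1})"
        using inv[of "y t" "V u t" "V v t"] by (simp add: add.commute)
    qed auto
    then show ?thesis by (simp add: V0)
  qed
  ultimately show ?thesis by blast
qed

end

section \<open>Homogeneous polynomials\<close>

text \<open>Homogeneous polynomials in the real and imaginary parts of the coordinates:
  \<open>bounded_linear\<close> is over the reals, so conjugates are included. Differentiability,
  growth and the symmetry of second derivatives become structural inductions. The zero function has
  every degree.\<close>

inductive hpoly :: "nat \<Rightarrow> (cpt \<Rightarrow> complex) \<Rightarrow> bool" where
  hpoly_const: "hpoly 0 (\<lambda>_. c)"
| hpoly_linear: "bounded_linear l \<Longrightarrow> hpoly (Suc 0) l"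
| hpoly_add: "hpoly n F \<Longrightarrow> hpoly n G \<Longrightarrow> hpoly n (\<lambda>z. F z + G z)"
| hpoly_mult: "hpoly m F \<Longrightarrow> hpoly n G \<Longrightarrow> hpoly (m + n) (\<lambda>z. F z * G z)"

lemma hpoly_cmult: "hpoly n F \<Longrightarrow> hpoly n (\<lambda>z. c * F z)"
  using hpoly_mult[OF hpoly_const[of c]] by simp

lemma hpoly_divide: "hpoly n F \<Longrightarrow> hpoly n (\<lambda>z. F z / c)"
  using hpoly_cmult[of n F "inverse c"] by (simp add: field_simps)

lemma hpoly_diff: "hpoly n F \<Longrightarrow> hpoly n G \<Longrightarrow> hpoly n (\<lambda>z. F z - G z)"
  using hpoly_add[of n F "\<lambda>z. -1 * G z"] hpoly_cmult[of n G "-1"] by simp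

lemma hpoly_zero: "hpoly n (\<lambda>_. 0)"
proof (induction n)
  case (Suc n)
  show ?case using hpoly_mult[OF hpoly_linear[OF bounded_linear_zero] Suc] by simp
qed (rule hpoly_const)

lemma hpoly_sum: "(\<And>i. i \<in> I \<Longrightarrow> hpoly n (F i)) \<Longrightarrow> hpoly n (\<lambda>z. \<Sum>i\<in>I. F i z)"
  by (induction I rule: infinite_finite_induct) (auto intro: hpoly_zero hpoly_add)

lemma hpoly_power:
  assumes "hpoly m F" shows "hpoly (k * m) (\<lambda>z. F z ^ k)"
proof (induction k)
  case (Suc k)
  show ?case using hpoly_mult[OF assms Suc] by simp
qed (simp add: hpoly_const)

lemma hpoly_degree_0: "hpoly n F \<Longrightarrow> n = 0 \<Longrightarrow> \<exists>c. F = (\<lambda>_. c)"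
  by (induction rule: hpoly.induct) auto

section \<open>Calculus of directional derivatives\<close>

lemma dir_deriv_eqI: "(F has_derivative F') (at z) \<Longrightarrow> dir_deriv F z v = F' v"
  unfolding dir_deriv_def by (simp add: frechet_derivative_at[symmetric])

lemma dir_deriv_works: "F differentiable at z \<Longrightarrow> (F has_derivative dir_deriv F z) (at z)"
  unfolding dir_deriv_def by (simp add: frechet_derivative_works)

lemma hpoly_differentiable: "hpoly n F \<Longrightarrow> F differentiable at z"
  by (induction rule: hpoly.induct)
    (auto intro: bounded_linear_imp_differentiable)

lemmas hpoly_has_derivative = dir_deriv_works[OF hpoly_differentiable]

lemma dir_deriv_const: "dir_deriv (\<lambda>_. c) z v = 0"
  by (rule dir_deriv_eqI) (rule has_derivative_const)

lemma dir_deriv_linear: "bounded_linear l \<Longrightarrow> dir_deriv l z v = l v"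
  by (rule dir_deriv_eqI) (rule bounded_linear_imp_has_derivative)

lemma dir_deriv_add:
  "F differentiable at z \<Longrightarrow> G differentiable at z \<Longrightarrow>
    dir_deriv (\<lambda>z. F z + G z) z v = dir_deriv F z v + dir_deriv G z v"
  by (rule dir_deriv_eqI) (intro has_derivative_add dir_deriv_works)

lemma dir_deriv_mult:
  "F differentiable at z \<Longrightarrow> G differentiable at z \<Longrightarrow>
    dir_deriv (\<lambda>z. F z * G z) z v = F z * dir_deriv G z v + dir_deriv F z v * G z"
  by (rule dir_deriv_eqI) (intro has_derivative_mult dir_deriv_works)

lemma dir_deriv_cmult:
  "F differentiable at z \<Longrightarrow> dir_deriv (\<lambda>z. c * F z) z v = c * dir_deriv F z v"
  by (simp add: dir_deriv_mult dir_deriv_const)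

lemma dir_deriv_divide:
  "F differentiable at z \<Longrightarrow> dir_deriv (\<lambda>z. F z / c) z v = dir_deriv F z v / c"
  using dir_deriv_cmult[of F z "inverse c" v] by (simp add: field_simps)

text \<open>In the product rule a factor of degree 0 has no degree to lose, but it is constant and
  its term vanishes.\<close>

lemma hpoly_dir_deriv:
  "hpoly n F \<Longrightarrow> n = Suc m \<Longrightarrow> hpoly m (\<lambda>z. dir_deriv F z v)"
proof (induction arbitrary: m rule: hpoly.induct)
  case (hpoly_linear l)
  then show ?case using hpoly_const[of "l v"] by (simp add: dir_deriv_linear)
next
  case (hpoly_add n F G)
  then show ?case
    by (simp add: dir_deriv_add hpoly_differentiable hpoly.hpoly_add)
next
  case (hpoly_mult a F b G)
  have "hpoly m (\<lambda>z. F z * dir_deriv G z v)"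
  proof (cases b)
    case 0
    then obtain c where "G = (\<lambda>_. c)" using hpoly_degree_0 hpoly_mult.hyps by blast
    then show ?thesis by (simp add: dir_deriv_const hpoly_zero)
  next
    case (Suc k)
    then show ?thesis
      using hpoly.hpoly_mult[OF hpoly_mult.hyps(1) hpoly_mult.IH(2)[OF Suc]] hpoly_mult.prems by simp
  qed
  moreover have "hpoly m (\<lambda>z. dir_deriv F z v * G z)"
  proof (cases a)
    case 0
    then obtain c where "F = (\<lambda>_. c)" using hpoly_degree_0 hpoly_mult.hyps by blast
    then show ?thesis by (simp add: dir_deriv_const hpoly_zero)
  next
    case (Suc k)
    then show ?thesis
      using hpoly.hpoly_mult[OF hpoly_mult.IH(1)[OF Suc] hpoly_mult.hyps(2)] hpoly_mult.prems by simp
  qed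
  ultimately show ?case
    using hpoly_mult.hyps by (simp add: dir_deriv_mult hpoly_differentiable hpoly.hpoly_add)
qed auto

lemma hpoly_dir_deriv_Suc: "hpoly (Suc n) F \<Longrightarrow> hpoly n (\<lambda>z. dir_deriv F z v)"
  by (rule hpoly_dir_deriv) auto

lemma hpoly_dir_deriv_differentiable:
  assumes "hpoly n F" shows "(\<lambda>z. dir_deriv F z v) differentiable at z"
proof (cases n)
  case 0
  then obtain c where "F = (\<lambda>_. c)" using hpoly_degree_0 assms by blast
  then show ?thesis by (simp add: dir_deriv_const)
next
  case (Suc m)
  then show ?thesis using assms hpoly_differentiable hpoly_dir_deriv by blast
qed

text \<open>Exchanging \<open>u\<close> and \<open>v\<close> permutes the mixed terms of the twice
  applied product rule, so the symmetry passes to products by induction.\<close>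

lemma dir_deriv_commute:
  "hpoly n F \<Longrightarrow> dir_deriv (\<lambda>z. dir_deriv F z u) z v = dir_deriv (\<lambda>z. dir_deriv F z v) z u"
  by (induction rule: hpoly.induct)
    (simp_all add: dir_deriv_const dir_deriv_linear dir_deriv_add dir_deriv_mult
      hpoly_differentiable hpoly_dir_deriv_differentiable algebra_simps)

section \<open>Growth and Lipschitz bounds from the degree\<close>

lemma hpoly_bound: "hpoly n F \<Longrightarrow> \<exists>C\<ge>0. \<forall>z. norm (F z) \<le> C * norm z ^ n"
proof (induction rule: hpoly.induct)
  case (hpoly_const c)
  show ?case by (rule exI[of _ "norm c"]) simp
next
  case (hpoly_linear l)
  then show ?case using bounded_linear.nonneg_bounded[of l] by (auto simp: mult.commute)
next
  case (hpoly_add n F G)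
  then obtain C D where "C \<ge> 0" "D \<ge> 0" "\<And>z. norm (F z) \<le> C * norm z ^ n" "\<And>z. norm (G z) \<le> D * norm z ^ n"
    by blast
  then show ?case
    by (intro exI[of _ "C + D"]) (auto simp: distrib_right intro: norm_triangle_mono)
next
  case (hpoly_mult m F n G)
  then obtain C D where CD: "C \<ge> 0" "D \<ge> 0" "\<And>z. norm (F z) \<le> C * norm z ^ m" "\<And>z. norm (G z) \<le> D * norm z ^ n"
    by blast
  have "norm (F z * G z) \<le> (C * D) * norm z ^ (m + n)" for z
  proof -
    have "norm (F z) * norm (G z) \<le> (C * norm z ^ m) * (D * norm z ^ n)"
      by (intro mult_mono CD) (use CD in auto)
    then show ?thesis by (simp add: norm_mult power_add mult_ac)
  qed
  then show ?case using CD by (intro exI[of _ "C * D"]) auto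
qed

lemma hpoly_at_zero:
  assumes "hpoly (Suc n) F" shows "F 0 = 0"
proof -
  obtain C where "\<And>z. norm (F z) \<le> C * norm z ^ Suc n" using hpoly_bound[OF assms] by blast
  from this[of 0] show ?thesis by simp
qed

text \<open>Constants for the basis vectors add up to one constant for all directions. The index
  \<open>i\<close> carries a base point, or a pair of them, and the bound stays uniform in
  it.\<close>

lemma uniform_bound_in_direction:
  fixes L :: "'i \<Rightarrow> 'a::euclidean_space \<Rightarrow> 'b::real_normed_vector"
  assumes lin: "\<And>i. linear (L i)" and nonneg: "\<And>i. 0 \<le> \<phi> i"
    and bnd: "\<And>b. \<exists>C\<ge>0. \<forall>i. norm (L i b) \<le> C * \<phi> i"
  shows "\<exists>C\<ge>0::real. \<forall>i v. norm (L i v) \<le> C * \<phi> i * norm v"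
proof -
  obtain C where C: "\<And>b. C b \<ge> 0" "\<And>b i. norm (L i b) \<le> C b * \<phi> i"
    using bnd by metis
  have "norm (L i v) \<le> (\<Sum>b\<in>Basis. C b) * \<phi> i * norm v" for i v
  proof -
    have "L i v = (\<Sum>b\<in>Basis. (v \<bullet> b) *\<^sub>R L i b)"
      by (subst euclidean_representation[of v, symmetric])
        (simp only: linear_sum[OF lin] linear_scale[OF lin])
    also have "norm \<dots> \<le> (\<Sum>b\<in>Basis. norm v * (C b * \<phi> i))"
      using C nonneg by (intro sum_norm_le) (auto intro!: mult_mono Basis_le_norm)
    finally show ?thesis by (simp add: sum_distrib_left sum_distrib_right mult_ac)
  qed
  then show ?thesis using C by (intro exI[of _ "\<Sum>b\<in>Basis. C b"]) (auto intro: sum_nonneg)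
qed

lemma hpoly_linear_dir_deriv: "hpoly n F \<Longrightarrow> linear (dir_deriv F z)"
  using hpoly_has_derivative has_derivative_linear by blast

lemma hpoly_dir_deriv_bound:
  assumes "hpoly (Suc n) F"
  shows "\<exists>C\<ge>0. \<forall>z v. norm (dir_deriv F z v) \<le> C * norm z ^ n * norm v"
  by (rule uniform_bound_in_direction[OF hpoly_linear_dir_deriv[OF assms] _
        hpoly_bound[OF hpoly_dir_deriv_Suc[OF assms]]]) simp

text \<open>In a fixed direction the derivative is quadratic, so its own derivative is bounded by a
  multiple of |x| + |y| on the ball of that radius, which contains both points; the mean value
  inequality applies there.\<close>

lemma hpoly_dir_deriv_lipschitz:
  assumes F: "hpoly 3 F"
  shows "\<exists>C\<ge>0. \<forall>x y v. norm (dir_deriv F x v - dir_deriv F y v)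
           \<le> C * ((norm x + norm y) * norm (x - y)) * norm v"
proof -
  define L :: "cpt \<times> cpt \<Rightarrow> cpt \<Rightarrow> complex"
    where "L p v = dir_deriv F (fst p) v - dir_deriv F (snd p) v" for p v
  define \<phi> :: "cpt \<times> cpt \<Rightarrow> real"
    where "\<phi> p = (norm (fst p) + norm (snd p)) * norm (fst p - snd p)" for p
  have "\<exists>C\<ge>0. \<forall>p v. norm (L p v) \<le> C * \<phi> p * norm v"
  proof (rule uniform_bound_in_direction)
    show "linear (L p)" for p
      unfolding L_def by (intro linear_compose_sub hpoly_linear_dir_deriv[OF F])
    show "0 \<le> \<phi> p" for p by (simp add: \<phi>_def)
    fix b
    have H: "hpoly (Suc (Suc 0)) (\<lambda>z. dir_deriv F z b)"
      by (rule hpoly_dir_deriv_Suc) (use F in \<open>simp add: numeral_3_eq_3\<close>)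
    obtain C where C: "C \<ge> 0" "\<And>z v. norm (dir_deriv (\<lambda>z. dir_deriv F z b) z v) \<le> C * norm z * norm v"
      using hpoly_dir_deriv_bound[OF H] unfolding power_Suc0_right by blast
    have bd: "norm (dir_deriv F x b - dir_deriv F y b) \<le> C * (norm x + norm y) * norm (x - y)" for x y
    proof (rule differentiable_bound[where S = "cball 0 (norm x + norm y)" and f = "\<lambda>z. dir_deriv F z b"
          and f' = "dir_deriv (\<lambda>z. dir_deriv F z b)"])
      show "((\<lambda>z. dir_deriv F z b) has_derivative dir_deriv (\<lambda>z. dir_deriv F z b) u)
              (at u within cball 0 (norm x + norm y))" for u
        by (rule has_derivative_at_withinI[OF hpoly_has_derivative[OF H]])
      show "onorm (dir_deriv (\<lambda>z. dir_deriv F z b) u) \<le> C * (norm x + norm y)"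
        if "u \<in> cball 0 (norm x + norm y)" for u
      proof (rule onorm_le)
        fix v :: cpt
        have "C * norm u * norm v \<le> C * (norm x + norm y) * norm v"
          using that C by (intro mult_right_mono mult_left_mono) auto
        then show "norm (dir_deriv (\<lambda>z. dir_deriv F z b) u v) \<le> C * (norm x + norm y) * norm v"
          using C(2)[of u v] by linarith
      qed
    qed auto
    have "norm (L p b) \<le> C * \<phi> p" for p
      unfolding L_def \<phi>_def mult.assoc[symmetric] by (rule bd)
    then show "\<exists>C\<ge>0. \<forall>p. norm (L p b) \<le> C * \<phi> p" using C(1) by blast
  qed
  then obtain C where C: "C \<ge> 0" "\<And>p v. norm (L p v) \<le> C * \<phi> p * norm v" by blast
  have "norm (dir_deriv F x v - dir_deriv F y v) \<le> C * ((norm x + norm y) * norm (x - y)) * norm v" for x y v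
    using C(2)[of "(x, y)" v] by (simp only: L_def \<phi>_def fst_conv snd_conv)
  then show ?thesis using C(1) by blast
qed

section \<open>Wirtinger derivatives and the Poisson bracket\<close>

lemma dir_deriv_expand:
  assumes "F differentiable at z"
  shows "dir_deriv F z v =
    Re (fst v) * dir_deriv F z (1,0) + Im (fst v) * dir_deriv F z (\<i>,0) +
    Re (snd v) * dir_deriv F z (0,1) + Im (snd v) * dir_deriv F z (0,\<i>)"
proof -
  interpret linear "dir_deriv F z"
    using dir_deriv_works[OF assms] by (rule has_derivative_linear)
  have "v = Re (fst v) *\<^sub>R (1,0) + Im (fst v) *\<^sub>R (\<i>,0) + Re (snd v) *\<^sub>R (0,1) + Im (snd v) *\<^sub>R (0,\<i>)"
    by (auto simp: prod_eq_iff complex_eq_iff)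
  then have "dir_deriv F z v = dir_deriv F z (Re (fst v) *\<^sub>R (1,0) + Im (fst v) *\<^sub>R (\<i>,0) + Re (snd v) *\<^sub>R (0,1) + Im (snd v) *\<^sub>R (0,\<i>))"
    by (rule arg_cong)
  then show ?thesis by (simp only: add scale scaleR_conv_of_real)
qed

text \<open>A real-linear map splits into a complex-linear and an antilinear part; the Wirtinger
  derivatives are their coefficients.\<close>

lemma dir_deriv_wirtinger:
  assumes "F differentiable at z"
  shows "dir_deriv F z v = wz1 F z * fst v + wzb1 F z * cnj (fst v) + wz2 F z * snd v + wzb2 F z * cnj (snd v)"
  unfolding dir_deriv_expand[OF assms, of v] wz1_def wzb1_def wz2_def wzb2_def
  by (cases "fst v"; cases "snd v") (simp add: complex_eq_iff field_simps)

lemma dir_deriv_real: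
  assumes "F differentiable at z" "\<And>z. Im (F z) = 0"
  shows "Im (dir_deriv F z v) = 0"
proof -
  have "((\<lambda>z. Im (F z)) has_derivative (\<lambda>v. Im (dir_deriv F z v))) (at z)"
    using dir_deriv_works[OF assms(1)] by (rule has_derivative_Im)
  then have "((\<lambda>z. 0::real) has_derivative (\<lambda>v. Im (dir_deriv F z v))) (at z)"
    by (simp add: assms(2))
  from has_derivative_unique[OF this has_derivative_const] show ?thesis by meson
qed

text \<open>For real \<open>S\<close> the derivatives in z_j and in its conjugate are conjugate to
  each other, so the antilinear part of the differential of \<open>F\<close> on
  \<open>hamvf S\<close> yields the terms with \<open>wz1 S\<close> and
  \<open>wz2 S\<close>.\<close>

lemma dir_deriv_hamvf:
  assumes "F differentiable at z" "S differentiable at z" "\<And>z. Im (S z) = 0"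
  shows "dir_deriv F z (hamvf S z) = pbracket S F z"
proof -
  have "cnj (wzb1 S z) = wz1 S z" "cnj (wzb2 S z) = wz2 S z"
    using dir_deriv_real[OF assms(2,3)] by (simp_all add: wz1_def wzb1_def wz2_def wzb2_def complex_eq_iff)
  then show ?thesis
    by (simp add: dir_deriv_wirtinger[OF assms(1)] hamvf_def pbracket_def algebra_simps)
qed

lemma hpoly_wirtinger:
  assumes "hpoly (Suc n) F"
  shows "hpoly n (wz1 F)" "hpoly n (wzb1 F)" "hpoly n (wz2 F)" "hpoly n (wzb2 F)"
  unfolding wz1_def[abs_def] wzb1_def[abs_def] wz2_def[abs_def] wzb2_def[abs_def]
  by (intro hpoly_divide hpoly_add hpoly_diff hpoly_cmult hpoly_dir_deriv_Suc assms)+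

lemma hpoly_pbracket: "hpoly (Suc m) F \<Longrightarrow> hpoly (Suc n) G \<Longrightarrow> hpoly (m + n) (pbracket F G)"
  unfolding pbracket_def[abs_def]
  by (intro hpoly_cmult hpoly_add hpoly_diff hpoly_mult hpoly_wirtinger)

section \<open>Quartic Hamiltonian vector fields\<close>

definition hamvf_deriv :: "(cpt \<Rightarrow> complex) \<Rightarrow> cpt \<Rightarrow> cpt \<Rightarrow> cpt" where
  "hamvf_deriv S z v = (- \<i> * dir_deriv (wzb1 S) z v, - \<i> * dir_deriv (wzb2 S) z v)"

lemma hamvf_cubic_field:
  assumes S: "hpoly 4 S"
  shows "\<exists>K. cubic_field (hamvf S) (hamvf_deriv S) K"
proof -
  have w: "hpoly 3 (wzb1 S)" "hpoly 3 (wzb2 S)"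
    using S by (auto intro!: hpoly_wirtinger)
  have w': "hpoly (Suc 2) (wzb1 S)" "hpoly (Suc 2) (wzb2 S)" using w by auto
  obtain C1 where C1: "C1 \<ge> 0" "\<And>z v. norm (dir_deriv (wzb1 S) z v) \<le> C1 * norm z ^ 2 * norm v"
    using hpoly_dir_deriv_bound[OF w'(1)] by blast
  obtain C2 where C2: "C2 \<ge> 0" "\<And>z v. norm (dir_deriv (wzb2 S) z v) \<le> C2 * norm z ^ 2 * norm v"
    using hpoly_dir_deriv_bound[OF w'(2)] by blast
  obtain D1 where D1: "D1 \<ge> 0" "\<And>x y v. norm (dir_deriv (wzb1 S) x v - dir_deriv (wzb1 S) y v)
           \<le> D1 * ((norm x + norm y) * norm (x - y)) * norm v"
    using hpoly_dir_deriv_lipschitz[OF w(1)] by metis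
  obtain D2 where D2: "D2 \<ge> 0" "\<And>x y v. norm (dir_deriv (wzb2 S) x v - dir_deriv (wzb2 S) y v)
           \<le> D2 * ((norm x + norm y) * norm (x - y)) * norm v"
    using hpoly_dir_deriv_lipschitz[OF w(2)] by metis
  \<comment> \<open>One constant serves all bounds; the summand 1 keeps it positive when
    \<open>S\<close> vanishes.\<close>
  define K where "K = C1 + C2 + D1 + D2 + 1"
  have "cubic_field (hamvf S) (hamvf_deriv S) K"
  proof
    fix x y v :: cpt
    show "(hamvf S has_derivative hamvf_deriv S x) (at x)"
      unfolding hamvf_def[abs_def] hamvf_deriv_def[abs_def]
      by (intro has_derivative_Pair has_derivative_mult_right hpoly_has_derivative[OF w(1)] hpoly_has_derivative[OF w(2)])
    show "hamvf S 0 = 0"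
      using hpoly_at_zero[OF w'(1)] hpoly_at_zero[OF w'(2)] by (simp add: hamvf_def zero_prod_def)
    show "K > 0" using C1 C2 D1 D2 by (simp add: K_def)
    have "norm (hamvf_deriv S x v) \<le> C1 * norm x ^ 2 * norm v + C2 * norm x ^ 2 * norm v"
      unfolding hamvf_deriv_def
      by (rule order_trans[OF norm_Pair_le]) (auto simp: norm_mult intro!: add_mono C1 C2)
    also have "\<dots> = (C1 + C2) * (norm x ^ 2 * norm v)" by (simp add: algebra_simps)
    also have "\<dots> \<le> K * (norm x ^ 2 * norm v)"
      using D1 D2 by (intro mult_right_mono) (auto simp: K_def)
    finally show "norm (hamvf_deriv S x v) \<le> K * norm x ^ 2 * norm v" by (simp add: mult.assoc)
    have "norm (hamvf_deriv S x v - hamvf_deriv S y v)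
       \<le> D1 * ((norm x + norm y) * norm (x - y)) * norm v + D2 * ((norm x + norm y) * norm (x - y)) * norm v"
      unfolding hamvf_deriv_def diff_Pair right_diff_distrib[symmetric]
      by (rule order_trans[OF norm_Pair_le]) (unfold norm_mult, simp, intro add_mono D1 D2)
    also have "\<dots> = (D1 + D2) * ((norm x + norm y) * norm (x - y) * norm v)" by (simp add: algebra_simps)
    also have "\<dots> \<le> K * ((norm x + norm y) * norm (x - y) * norm v)"
      using C1 C2 by (intro mult_right_mono) (auto simp: K_def)
    finally show "norm (hamvf_deriv S x v - hamvf_deriv S y v) \<le> K * (norm x + norm y) * norm (x - y) * norm v"
      by (simp add: mult.assoc)
    have c: "continuous_on UNIV (\<lambda>x. dir_deriv F x v)" if "hpoly 3 F" for F
      using that by (intro differentiable_imp_continuous_on)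
        (auto simp: differentiable_on_def intro: hpoly_dir_deriv_differentiable)
    show "continuous_on UNIV (\<lambda>x. hamvf_deriv S x v)"
      unfolding hamvf_deriv_def by (intro continuous_intros c w)
  qed
  then show ?thesis by blast
qed

lemma bounded_bilinear_sympl: "bounded_bilinear sympl"
  unfolding bilinear_conv_bounded_bilinear[symmetric] bilinear_def sympl_def
  by (auto intro!: linearI simp: algebra_simps)

text \<open>The two terms are half the second derivative of \<open>S\<close> in the directions \<open>u\<close>, \<open>v\<close>, taken in
  either order, with opposite signs.\<close>

lemma hamvf_deriv_infinitesimally_symplectic:
  assumes S: "hpoly n S" and real: "\<And>z. Im (S z) = 0"
  shows "sympl (hamvf_deriv S x u) v + sympl u (hamvf_deriv S x v) = 0"
proof -
  define d where "d a b = dir_deriv (\<lambda>z. dir_deriv S z a) x b" for a b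
  have diff: "(\<lambda>z. dir_deriv S z a) differentiable at z" for a z
    by (rule hpoly_dir_deriv_differentiable[OF S])
  have d_real: "Im (d a b) = 0" for a b
    unfolding d_def
    by (rule dir_deriv_real[OF diff dir_deriv_real[OF hpoly_differentiable[OF S] real]])
  have d_sym: "d a b = d b a" for a b
    unfolding d_def by (rule dir_deriv_commute[OF S])
  \<comment> \<open>The second slot is expanded in real coordinates and the slots are then swapped,
    because \<open>w1\<close> and \<open>w2\<close> produce coordinate directions in the first
    slot.\<close>
  have d_exp: "Re (d a b) = Re (fst b) * Re (d (1,0) a) + Im (fst b) * Re (d (\<i>,0) a)
      + Re (snd b) * Re (d (0,1) a) + Im (snd b) * Re (d (0,\<i>) a)" for a b
  proof -
    have "d a b = Re (fst b) * d a (1,0) + Im (fst b) * d a (\<i>,0) + Re (snd b) * d a (0,1) + Im (snd b) * d a (0,\<i>)"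
      unfolding d_def by (rule dir_deriv_expand[OF diff])
    also have "\<dots> = Re (fst b) * d (1,0) a + Im (fst b) * d (\<i>,0) a + Re (snd b) * d (0,1) a + Im (snd b) * d (0,\<i>) a"
      by (simp only: d_sym[of a])
    finally show ?thesis by simp
  qed
  have w1: "dir_deriv (wzb1 S) x a = (d (1,0) a + \<i> * d (\<i>,0) a) / 2"
    and w2: "dir_deriv (wzb2 S) x a = (d (0,1) a + \<i> * d (0,\<i>) a) / 2" for a
    unfolding wzb1_def[abs_def] wzb2_def[abs_def] d_def
    by (simp_all add: dir_deriv_divide dir_deriv_add dir_deriv_cmult diff)
  have "sympl (hamvf_deriv S x u) v = Re (d u v) / 2"
    unfolding d_exp[of u v] sympl_def hamvf_deriv_def w1 w2
    by (simp add: d_real field_simps)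
  moreover have "sympl u (hamvf_deriv S x v) = - Re (d v u) / 2"
    unfolding d_exp[of v u] sympl_def hamvf_deriv_def w1 w2
    by (simp add: d_real field_simps)
  ultimately show ?thesis using d_sym[of u v] by simp
qed

section \<open>Transport along the flow and the normal form estimate\<close>

lemma maxnorm_le_norm: "maxnorm z \<le> norm z"
  unfolding maxnorm_def using norm_fst_le[of "fst z" "snd z"] norm_snd_le[of "snd z" "fst z"] by simp

lemma norm_le_maxnorm: "norm z \<le> 2 * maxnorm z"
  unfolding maxnorm_def using norm_Pair_le[of "fst z" "snd z"] by simp

lemma maxnorm_nonneg: "0 \<le> maxnorm z"
  by (simp add: maxnorm_def le_max_iff_disj)

lemma flow_sol_iff: "flow_sol S z y \<longleftrightarrow> ode_sol (\<lambda>_. hamvf S) z y"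
  by (simp add: flow_sol_def ode_sol_def)

lemma flow1_eq_time_one: "flow1 S = time_one (hamvf S)"
  by (rule ext) (simp add: flow1_def time_one_def flow_sol_iff)

lemma has_vector_derivative_along_solution:
  assumes "ode_sol (\<lambda>_. X) z y" "F differentiable at (y t)" "t \<in> {0..1}"
  shows "((\<lambda>t. F (y t)) has_vector_derivative dir_deriv F (y t) (X (y t))) (at t within {0..1})"
proof -
  have "(y has_vector_derivative X (y t)) (at t within {0..1})"
    using assms by (simp add: ode_sol_def)
  from vector_derivative_diff_chain_within[OF this has_derivative_at_withinI[OF dir_deriv_works[OF assms(2)]]]
  show ?thesis by (simp add: o_def)
qed

text \<open>The rate of change pairs a derivative of degree \<open>n\<close> with a cubic field, two
  orders more than \<open>F\<close> itself. The factor \<open>2 ^ (n + 3)\<close> reflects orbits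
  staying within twice the initial norm.\<close>

lemma hpoly_change_along_flow:
  assumes X: "cubic_field X DX K" and F: "hpoly (Suc n) F"
  shows "\<exists>C\<ge>0. \<forall>z y t. ode_sol (\<lambda>_. X) z y \<longrightarrow> (\<forall>s\<in>{0..1}. norm (y s) \<le> 2 * norm z) \<longrightarrow> t \<in> {0..1} \<longrightarrow>
           norm (F (y t) - F z) \<le> C * norm z ^ (n + 3)"
proof -
  interpret cubic_field X DX K by (rule X)
  obtain C where C: "C \<ge> 0" "\<And>z v. norm (dir_deriv F z v) \<le> C * norm z ^ n * norm v"
    using hpoly_dir_deriv_bound[OF F] by blast
  have "norm (F (y t) - F z) \<le> (C * K * 2 ^ (n + 3)) * norm z ^ (n + 3)"
    if y: "ode_sol (\<lambda>_. X) z y" and small: "\<forall>s\<in>{0..1}. norm (y s) \<le> 2 * norm z" and t: "t \<in> {0..1}" for z y t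
  proof -
    have "norm (F (y t) - F (y 0)) \<le> (C * K * 2 ^ (n + 3)) * norm z ^ (n + 3)"
    proof (rule vector_derivative_bound_unit[where g = "\<lambda>t. F (y t)"])
      show "((\<lambda>t. F (y t)) has_vector_derivative dir_deriv F (y s) (X (y s))) (at s within {0..1})"
        if "s \<in> {0..1}" for s
        by (rule has_vector_derivative_along_solution[OF y hpoly_differentiable[OF F] that])
      fix s :: real assume s: "s \<in> {0..1}"
      have "norm (dir_deriv F (y s) (X (y s))) \<le> C * norm (y s) ^ n * (K * norm (y s) ^ 3)"
        by (rule order_trans[OF C(2)]) (use C K_pos in \<open>auto intro!: mult_left_mono norm_le\<close>)
      also have "\<dots> = (C * K) * norm (y s) ^ (n + 3)" by (simp add: power_add)
      also have "\<dots> \<le> (C * K) * (2 * norm z) ^ (n + 3)"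
        using small s C K_pos by (intro mult_left_mono power_mono) auto
      finally show "norm (dir_deriv F (y s) (X (y s))) \<le> (C * K * 2 ^ (n + 3)) * norm z ^ (n + 3)"
        by (simp only: power_mult_distrib mult.assoc)
    qed (use t in auto)
    then show ?thesis using y by (simp add: ode_sol_def)
  qed
  then show ?thesis using C K_pos by (intro exI[of _ "C * K * 2 ^ (n + 3)"]) auto
qed

text \<open>The conclusion shared by the resonant and nonresonant cases, in the shape of the final
  statement so that it unfolds into it. \<open>S\<close> is the generator and \<open>Z\<close> the
  quartic part that is kept.\<close>

definition near_identity_normal_form ::
  "(cpt \<Rightarrow> complex) \<Rightarrow> (cpt \<Rightarrow> complex) \<Rightarrow> (cpt \<Rightarrow> complex) \<Rightarrow> (cpt \<Rightarrow> complex) \<Rightarrow> bool" where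
  "near_identity_normal_form S H N Z \<longleftrightarrow> (\<exists>r>0. \<exists>C.
        (\<forall>z. maxnorm z < r \<longrightarrow> (\<exists>y. flow_sol S z y)) \<and>
        inj_on (flow1 S) {z. maxnorm z < r} \<and>
        (\<forall>z. maxnorm z < r \<longrightarrow> (\<exists>D. (flow1 S has_derivative D) (at z) \<and>
              (\<forall>u v. sympl (D u) (D v) = sympl u v))) \<and>
        (\<forall>z. maxnorm z < r \<longrightarrow> maxnorm (flow1 S z - z) \<le> C * maxnorm z ^ 3) \<and>
        (\<forall>z. maxnorm z < r \<longrightarrow>
              cmod (H (flow1 S z) - N z - Z z) \<le> C * maxnorm z ^ 6))"

lemma normal_form:
  assumes S: "hpoly 4 S" and real: "\<And>z. Im (S z) = 0"
    and N: "hpoly 2 N" and G: "hpoly 4 G"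
    and hom: "\<And>z. G z + pbracket S N z = Z z"
  shows "near_identity_normal_form S (\<lambda>z. N z + G z) N Z"
proof -
  obtain K where X: "cubic_field (hamvf S) (hamvf_deriv S) K"
    using hamvf_cubic_field[OF S] by blast
  interpret cubic_field "hamvf S" "hamvf_deriv S" K by (rule X)
  let ?Q = "pbracket S N" and ?\<Phi> = "time_one (hamvf S)"
  have Q: "hpoly (Suc 3) ?Q"
    using hpoly_pbracket[of 3 S 1 N] S N by (simp add: numeral_2_eq_2)
  have G': "hpoly (Suc 3) G" using G by simp
  obtain CG where CG: "CG \<ge> 0" "\<And>z y t. ode_sol (\<lambda>_. hamvf S) z y \<Longrightarrow>
      (\<forall>s\<in>{0..1}. norm (y s) \<le> 2 * norm z) \<Longrightarrow> t \<in> {0..1} \<Longrightarrow> norm (G (y t) - G z) \<le> CG * norm z ^ 6"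
    using hpoly_change_along_flow[OF X G'] by auto
  obtain CQ where CQ: "CQ \<ge> 0" "\<And>z y t. ode_sol (\<lambda>_. hamvf S) z y \<Longrightarrow>
      (\<forall>s\<in>{0..1}. norm (y s) \<le> 2 * norm z) \<Longrightarrow> t \<in> {0..1} \<Longrightarrow> norm (?Q (y t) - ?Q z) \<le> CQ * norm z ^ 6"
    using hpoly_change_along_flow[OF X Q] by auto
  \<comment> \<open>\<open>norm\<close> is at most twice \<open>maxnorm\<close>, so this radius lies
    inside the \<open>norm\<close> ball of radius \<open>rho / 2\<close>.\<close>
  define r where "r = rho / 4"
  \<comment> \<open>In the cubic estimate 64 is 8 from orbits within \<open>2 * norm z\<close> times
    2^3 from passing to \<open>maxnorm\<close>; in the sextic one it is 2^6 from that passage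
    alone.\<close>
  define C where "C = 64 * (K + CG + CQ)"
  have r: "r > 0" using rho_pos by (simp add: r_def)
  have small: "norm z < rho / 2" if "maxnorm z < r" for z
    using norm_le_maxnorm[of z] that by (simp add: r_def)
  have estimates: "maxnorm (?\<Phi> z - z) \<le> C * maxnorm z ^ 3"
      "cmod (N (?\<Phi> z) + G (?\<Phi> z) - N z - Z z) \<le> C * maxnorm z ^ 6" if z: "maxnorm z < r" for z
  proof -
    obtain y where y: "ode_sol (\<lambda>_. hamvf S) z y" and y2: "\<forall>t\<in>{0..1}. norm (y t) \<le> 2 * norm z"
      using solution_exists[of z] small[OF z] by auto
    have y1: "?\<Phi> z = y 1" and y0: "y 0 = z"
      using time_one_eq[OF y] y by (auto simp: ode_sol_def)
    have pow: "norm z ^ n \<le> 2 ^ n * maxnorm z ^ n" for n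
      using power_mono[OF norm_le_maxnorm norm_ge_zero, of z n] by (simp add: power_mult_distrib)
    have "norm (y 1 - y 0) \<le> K * 8 * norm z ^ 3"
    proof (rule vector_derivative_bound_unit)
      show "(y has_vector_derivative hamvf S (y t)) (at t within {0..1})" if "t \<in> {0..1}" for t
        using y that by (simp add: ode_sol_def)
      fix t :: real assume t: "t \<in> {0..1}"
      have "norm (hamvf S (y t)) \<le> K * norm (y t) ^ 3" by (rule norm_le)
      also have "\<dots> \<le> K * (2 * norm z) ^ 3"
        using y2 t K_pos by (intro mult_left_mono power_mono) auto
      finally show "norm (hamvf S (y t)) \<le> K * 8 * norm z ^ 3" by (simp add: power_mult_distrib)
    qed auto
    also have "\<dots> \<le> K * 8 * (2 ^ 3 * maxnorm z ^ 3)"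
      using K_pos by (intro mult_left_mono pow) auto
    also have "\<dots> = (64 * K) * maxnorm z ^ 3" by simp
    also have "\<dots> \<le> C * maxnorm z ^ 3"
      using CG CQ maxnorm_nonneg[of z] by (intro mult_right_mono) (auto simp: C_def)
    finally show "maxnorm (?\<Phi> z - z) \<le> C * maxnorm z ^ 3"
      using maxnorm_le_norm[of "y 1 - y 0"] by (simp add: y1 y0)
    \<comment> \<open>Subtracting the first-order term leaves the derivative
      \<open>?Q (y t) - ?Q z\<close>, already of order six.\<close>
    let ?g = "\<lambda>t. N (y t) - t *\<^sub>R ?Q z"
    have "norm (?g 1 - ?g 0) \<le> CQ * norm z ^ 6"
    proof (rule vector_derivative_bound_unit[where g = ?g])
      fix t :: real assume t: "t \<in> {0..1}"
      have "((\<lambda>t. N (y t)) has_vector_derivative ?Q (y t)) (at t within {0..1})"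
        using has_vector_derivative_along_solution[OF y hpoly_differentiable[OF N] t]
        by (simp add: dir_deriv_hamvf hpoly_differentiable[OF N] hpoly_differentiable[OF S] real)
      then show "(?g has_vector_derivative ?Q (y t) - ?Q z) (at t within {0..1})"
        by (auto intro!: derivative_eq_intros)
      show "norm (?Q (y t) - ?Q z) \<le> CQ * norm z ^ 6" by (rule CQ(2)[OF y y2 t])
    qed auto
    then have 1: "norm (N (y 1) - N z - ?Q z) \<le> CQ * norm z ^ 6"
      by (simp add: y0 algebra_simps)
    have 2: "norm (G (y 1) - G z) \<le> CG * norm z ^ 6" by (rule CG(2)[OF y y2]) auto
    have "N (y 1) + G (y 1) - N z - Z z = (N (y 1) - N z - ?Q z) + (G (y 1) - G z)"
      using hom[of z] by (simp add: algebra_simps flip: hom)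
    also have "norm \<dots> \<le> CQ * norm z ^ 6 + CG * norm z ^ 6"
      by (rule norm_triangle_mono[OF 1 2])
    also have "\<dots> = (CQ + CG) * norm z ^ 6" by (simp add: algebra_simps)
    also have "\<dots> \<le> (CQ + CG) * (2 ^ 6 * maxnorm z ^ 6)"
      using CG CQ by (intro mult_left_mono pow) auto
    also have "\<dots> = (64 * (CQ + CG)) * maxnorm z ^ 6" by simp
    also have "\<dots> \<le> C * maxnorm z ^ 6"
      using K_pos by (intro mult_right_mono) (auto simp: C_def)
    finally show "cmod (N (?\<Phi> z) + G (?\<Phi> z) - N z - Z z) \<le> C * maxnorm z ^ 6"
      by (simp add: y1)
  qed
  show ?thesis
    unfolding near_identity_normal_form_def flow1_eq_time_one flow_sol_iff
  proof (rule exI[of _ r], rule conjI[OF r], rule exI[of _ C], intro conjI allI impI)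
    show "\<exists>y. ode_sol (\<lambda>_. hamvf S) z y" if "maxnorm z < r" for z
      using solution_exists[of z] small[OF that] by auto
    show "inj_on ?\<Phi> {z. maxnorm z < r}"
      by (rule inj_on_subset[OF time_one_inj]) (use small in force)
    show "\<exists>D. (?\<Phi> has_derivative D) (at z) \<and> (\<forall>u v. sympl (D u) (D v) = sympl u v)"
      if "maxnorm z < r" for z
      by (rule time_one_derivative[OF small[OF that] bounded_bilinear_sympl
            hamvf_deriv_infinitesimally_symplectic[OF S real]])
  qed (fact estimates)+
qed

section \<open>The homological equation\<close>

lemma finite_idx4: "finite idx4"
  by (rule finite_subset[of _ "({..4} \<times> {..4}) \<times> ({..4} \<times> {..4})"]) (auto simp: idx4_def)

lemma hpoly_fst: "hpoly 1 fst" and hpoly_snd: "hpoly 1 snd"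
  and hpoly_cnj_fst: "hpoly 1 (\<lambda>z. cnj (fst z))" and hpoly_cnj_snd: "hpoly 1 (\<lambda>z. cnj (snd z))"
  unfolding One_nat_def
  by (intro hpoly_linear bounded_linear_fst bounded_linear_snd
      bounded_linear_compose[OF bounded_linear_cnj])+

lemma hpoly_mono: "hpoly (fst a + snd a + fst b + snd b) (mono a b)"
proof -
  have "hpoly (fst a * 1 + snd a * 1 + fst b * 1 + snd b * 1) (mono a b)"
    unfolding mono_def[abs_def]
    by (intro hpoly_mult hpoly_power hpoly_fst hpoly_snd hpoly_cnj_fst hpoly_cnj_snd)
  then show ?thesis by simp
qed

lemma hpoly_qpoly: "hpoly 4 (qpoly c)"
  unfolding qpoly_def[abs_def]
proof (rule hpoly_sum)
  fix p assume "p \<in> idx4"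
  then obtain a b where p: "p = (a, b)" "fst a + snd a + fst b + snd b = 4"
    by (auto simp: idx4_def)
  show "hpoly 4 (\<lambda>z. case p of (a, b) \<Rightarrow> c a b * mono a b z)"
    using hpoly_cmult[OF hpoly_mono[of a b], of "c a b"] p by simp
qed

lemma Nham_eq: "Nham wm wp = (\<lambda>z. wm * (fst z * cnj (fst z)) + wp * (snd z * cnj (snd z)))"
  by (rule ext) (simp add: Nham_def complex_norm_square flip: of_real_power)

lemma hpoly_Nham: "hpoly 2 (Nham wm wp)"
proof -
  have "hpoly (1 + 1) (Nham wm wp)" unfolding Nham_eq
    by (intro hpoly_add hpoly_cmult hpoly_mult hpoly_fst hpoly_snd hpoly_cnj_fst hpoly_cnj_snd)
  then show ?thesis by (simp add: numeral_2_eq_2)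
qed

text \<open>Conjugation exchanges the two multi-indices of a monomial, and \<open>idx4\<close> is
  invariant under this exchange.\<close>

lemma qpoly_real:
  assumes "\<And>a b. cnj (c a b) = c b a"
  shows "Im (qpoly c z) = 0"
proof -
  have "cnj (qpoly c z) = (\<Sum>(a, b)\<in>idx4. c b a * mono b a z)"
    unfolding qpoly_def cnj_sum
    by (intro sum.cong) (auto simp: assms mono_def)
  also have "\<dots> = qpoly c z"
    unfolding qpoly_def
    by (rule sum.reindex_bij_witness[of _ prod.swap prod.swap]) (auto simp: idx4_def)
  finally show ?thesis by (simp add: complex_eq_iff)
qed

lemma dir_deriv_sum:
  "(\<And>i. i \<in> I \<Longrightarrow> F i differentiable at z) \<Longrightarrow>
    dir_deriv (\<lambda>z. \<Sum>i\<in>I. F i z) z v = (\<Sum>i\<in>I. dir_deriv (F i) z v)"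
  by (rule dir_deriv_eqI) (intro has_derivative_sum dir_deriv_works)

text \<open>The Hamiltonian vector field of \<open>Nham\<close> is, up to sign, the rotation generator
  \<open>(\<i> \<omega>\<^sub>- z\<^sub>1, \<i> \<omega>\<^sub>+ z\<^sub>2)\<close>, of which the monomials are eigenvectors.\<close>

lemma pbracket_Nham:
  assumes "F differentiable at z"
  shows "pbracket F (Nham wm wp) z = dir_deriv F z (\<i> * wm * fst z, \<i> * wp * snd z)"
proof -
  have d: "dir_deriv (Nham wm wp) z v =
      wm * (fst z * cnj (fst v) + fst v * cnj (fst z)) + wp * (snd z * cnj (snd v) + snd v * cnj (snd z))" for v
    unfolding Nham_eq by (rule dir_deriv_eqI) (auto intro!: derivative_eq_intros)
  have "wz1 (Nham wm wp) z = wm * cnj (fst z)" "wzb1 (Nham wm wp) z = wm * fst z"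
    "wz2 (Nham wm wp) z = wp * cnj (snd z)" "wzb2 (Nham wm wp) z = wp * snd z"
    unfolding wz1_def wzb1_def wz2_def wzb2_def d by (simp_all add: algebra_simps)
  then show ?thesis
    unfolding dir_deriv_wirtinger[OF assms] pbracket_def by (simp add: algebra_simps)
qed

text \<open>Each factor z_j contributes i times its frequency and each conjugate factor the
  opposite.\<close>

lemma pbracket_mono_Nham:
  "pbracket (mono a b) (Nham wm wp) z = \<i> * omdot wm wp a b * mono a b z"
proof -
  have P: "dir_deriv (\<lambda>z. fst z ^ n) z (\<i> * wm * fst z, v) = n * (\<i> * wm) * fst z ^ n"
    "dir_deriv (\<lambda>z. snd z ^ n) z (v, \<i> * wp * snd z) = n * (\<i> * wp) * snd z ^ n"
    "dir_deriv (\<lambda>z. cnj (fst z) ^ n) z (\<i> * wm * fst z, v) = - n * (\<i> * wm) * cnj (fst z) ^ n"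
    "dir_deriv (\<lambda>z. cnj (snd z) ^ n) z (v, \<i> * wp * snd z) = - n * (\<i> * wp) * cnj (snd z) ^ n"
    for n v
    \<comment> \<open>The power rule leaves exponent n - 1, which recombines to n only for n > 0; at
      n = 0 the coefficient is 0.\<close>
    by (rule trans[OF dir_deriv_eqI], (rule derivative_eq_intros refl)+, cases n, simp_all)+
  note hp = hpoly_power[OF hpoly_fst] hpoly_power[OF hpoly_snd] hpoly_power[OF hpoly_cnj_fst]
    hpoly_power[OF hpoly_cnj_snd]
  show ?thesis
    unfolding pbracket_Nham[OF hpoly_differentiable[OF hpoly_mono]]
    unfolding mono_def[abs_def] omdot_def
    by (subst dir_deriv_mult P | intro differentiable_mult hp[THEN hpoly_differentiable])+
      (simp add: algebra_simps)
qed

lemma pbracket_qpoly_Nham: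
  "pbracket (qpoly c) (Nham wm wp) z = qpoly (\<lambda>a b. \<i> * omdot wm wp a b * c a b) z"
proof -
  have m: "mono a b differentiable at z" for a b by (rule hpoly_differentiable[OF hpoly_mono])
  show ?thesis
    unfolding pbracket_Nham[OF hpoly_differentiable[OF hpoly_qpoly]] unfolding qpoly_def[abs_def]
    by (subst dir_deriv_sum)
      (auto simp: m dir_deriv_cmult pbracket_mono_Nham simp flip: pbracket_Nham intro!: sum.cong)
qed

section \<open>Expansion of the quartic potential in complex monomials\<close>

lemma quartic_binomial:
  "M3 / 4 * (p * x + q * y) ^ 4 + N3 / 4 * (r * x + s * y) ^ 4 =
   (\<Sum>i\<le>4. 6 / (fact i * fact (4 - i)) * (p ^ i * q ^ (4 - i) * M3 + r ^ i * s ^ (4 - i) * N3)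
      * x ^ i * y ^ (4 - i))" for x y :: real
  \<comment> \<open>The coefficient 6/(i! (4-i)!) is one quarter of the binomial
    coefficient.\<close>
  by (simp add: numeral_eq_Suc field_simps fact_numeral)

text \<open>Regrouping by the total degree \<open>i\<close> in the first coordinate and its
  conjugate; \<open>k\<close> and \<open>l\<close> are the exponents of the unconjugated
  coordinates.\<close>

lemma sum_idx4:
  "(\<Sum>(a, b)\<in>idx4. g a b) =
   (\<Sum>i\<le>4. \<Sum>k\<le>i. \<Sum>l\<le>4 - i. g (k, l) (i - k, 4 - i - l))"
proof -
  have "(\<Sum>i\<le>4. \<Sum>k\<le>i. \<Sum>l\<le>4 - i. g (k, l) (i - k, 4 - i - l)) =
     (\<Sum>(i, k, l)\<in>(SIGMA i:{..4}. {..i} \<times> {..4 - i}). g (k, l) (i - k, 4 - i - l))"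
    by (simp add: sum.Sigma sum.cartesian_product)
  also have "\<dots> = (\<Sum>(a, b)\<in>idx4. g a b)"
    by (rule sum.reindex_bij_witness[of _ "\<lambda>(a, b). (fst a + fst b, fst a, snd a)"
          "\<lambda>(i, k, l). ((k, l), (i - k, 4 - i - l))"])
      (auto simp: idx4_def)
  finally show ?thesis ..
qed

lemma Gham_eq_qpoly:
  assumes "wm > 0" "wp > 0"
  shows "Gham wm wp Phi M3 N3 = qpoly (\<lambda>a b. complex_of_real (Gcoef wm wp Phi M3 N3 a b))"
proof
  fix z :: cpt
  define x where "x = Re (fst z + cnj (fst z))"
  define y where "y = Re (snd z + cnj (snd z))"
  have x: "complex_of_real x = fst z + cnj (fst z)" and y: "complex_of_real y = snd z + cnj (snd z)"
    by (auto simp: x_def y_def complex_eq_iff)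
  have pq: "(x / sqrt (2 * wm)) ^ i * (y / sqrt (2 * wp)) ^ (4 - i)
      = x ^ i * y ^ (4 - i) / (4 * sqrt wm ^ i * sqrt wp ^ (4 - i))" if "i \<le> 4" for i
  proof -
    \<comment> \<open>Here arises the factor 4 in the denominator of \<open>Gcoef\<close>.\<close>
    have "sqrt 2 ^ i * sqrt 2 ^ (4 - i) = sqrt 2 ^ (2 * 2)"
      using that by (simp flip: power_add)
    also have "\<dots> = 4" by (simp only: power_mult) simp
    finally have "sqrt (2 * wm) ^ i * sqrt (2 * wp) ^ (4 - i) = 4 * sqrt wm ^ i * sqrt wp ^ (4 - i)"
      by (simp add: real_sqrt_mult power_mult_distrib mult_ac)
    then show ?thesis by (simp add: power_divide)
  qed
  have "Gham wm wp Phi M3 N3 z = complex_of_real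
     (\<Sum>i\<le>4. fcoef Phi M3 N3 i (4 - i) / (4 * sqrt wm ^ i * sqrt wp ^ (4 - i)) * (x ^ i * y ^ (4 - i)))"
    unfolding Gham_def ffun_def quartic_binomial x_def[symmetric] y_def[symmetric]
    by (intro arg_cong[of _ _ complex_of_real] sum.cong refl)
      (simp add: pq fcoef_def mult.assoc)
  also have "\<dots> = (\<Sum>i\<le>4. \<Sum>k\<le>i. \<Sum>l\<le>4 - i.
      complex_of_real (Gcoef wm wp Phi M3 N3 (k, l) (i - k, 4 - i - l)) * mono (k, l) (i - k, 4 - i - l) z)"
    unfolding of_real_sum
  proof (rule sum.cong[OF refl])
    fix i :: nat assume i: "i \<in> {..4}"
    \<comment> \<open>\<open>Gcoef\<close> adds the two exponents back together; under truncated
      subtraction this needs the bound on \<open>l\<close>.\<close>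
    have e: "l + (4 - (i + l)) = 4 - i" if "l \<le> 4 - i" for l using that by arith
    have "complex_of_real (x ^ i * y ^ (4 - i)) =
      (\<Sum>k\<le>i. \<Sum>l\<le>4 - i. of_nat (i choose k) * fst z ^ k * cnj (fst z) ^ (i - k) *
         (of_nat ((4 - i) choose l) * snd z ^ l * cnj (snd z) ^ (4 - i - l)))"
      by (simp add: x y binomial_ring sum_product)
    then show "complex_of_real (fcoef Phi M3 N3 i (4 - i) / (4 * sqrt wm ^ i * sqrt wp ^ (4 - i)) * (x ^ i * y ^ (4 - i)))
      = (\<Sum>k\<le>i. \<Sum>l\<le>4 - i.
      complex_of_real (Gcoef wm wp Phi M3 N3 (k, l) (i - k, 4 - i - l)) * mono (k, l) (i - k, 4 - i - l) z)"
      unfolding of_real_mult[of "_ / _"]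
      by (simp only: sum_distrib_left)
        (intro sum.cong refl, auto simp: Gcoef_def mono_def e mult_ac)
  qed
  also have "\<dots> = qpoly (\<lambda>a b. complex_of_real (Gcoef wm wp Phi M3 N3 a b)) z"
    unfolding qpoly_def by (rule sum_idx4[symmetric])
  finally show "Gham wm wp Phi M3 N3 z = qpoly (\<lambda>a b. complex_of_real (Gcoef wm wp Phi M3 N3 a b)) z" .
qed

section \<open>Resonances and small divisors\<close>

definition resonant_pairs :: "(midx \<times> midx) set" where
  "resonant_pairs = {((3,0),(0,1)), ((0,1),(3,0))}"

lemma resonant_pairs_irrefl: "(a, a) \<notin> resonant_pairs"
  by (auto simp: resonant_pairs_def)

text \<open>Naming the set keeps simplification from splitting membership into equations between
  indices.\<close>

lemma Sres_coef_eq: "Sres_coef wm wp Phi M3 N3 a b =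
    (if a \<noteq> b \<and> (a, b) \<notin> resonant_pairs
     then \<i> * complex_of_real (Gcoef wm wp Phi M3 N3 a b / omdot wm wp a b) else 0)"
  by (simp only: Sres_coef_def resonant_pairs_def)

lemma resonant_pairs_commute: "(b, a) \<in> resonant_pairs \<longleftrightarrow> (a, b) \<in> resonant_pairs"
  by (auto simp: resonant_pairs_def)

text \<open>\<open>\<alpha> - \<beta>\<close> has even entry sum and \<open>l\<^sup>1\<close>-norm at most 4, so that \<open>\<plusminus>(3,-1)\<close> are its only values with entries
  of opposite signs and the first one larger in modulus.\<close>

lemma omdot_nonzero:
  assumes w: "0 < wm" "wm < wp" and ab: "(a, b) \<in> idx4" "a \<noteq> b"
    and res: "(a, b) \<notin> resonant_pairs \<or> wp \<noteq> 3 * wm"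
  shows "omdot wm wp a b \<noteq> 0"
proof
  obtain a1 a2 b1 b2 where e: "a = (a1, a2)" "b = (b1, b2)" by (cases a, cases b)
  assume "omdot wm wp a b = 0"
  then have 0: "wm * (real a1 - real b1) + wp * (real a2 - real b2) = 0"
    by (simp add: omdot_def e)
  \<comment> \<open>Two sign patterns are excluded. If both differences are nonnegative, their
    weighted sum vanishes only when both do. If the second is negative and at least as large in
    modulus, \<open>wm < wp\<close> makes it dominate.\<close>
  have gen: False
    if "wm * (real c1 - real d1) = wp * (real d2 - real c2)"
      and "c1 \<noteq> d1 \<or> c2 \<noteq> d2" and "c1 \<ge> d1" "c2 \<ge> d2 \<or> c1 - d1 \<le> d2 - c2"
    for c1 c2 d1 d2 :: nat
  proof (cases "c2 \<ge> d2")
    case True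
    have "wm * (real c1 - real d1) \<ge> 0" "wp * (real c2 - real d2) \<ge> 0"
      using True that(3) w by (intro mult_nonneg_nonneg; simp)+
    moreover have "wp * (real d2 - real c2) = - (wp * (real c2 - real d2))"
      by (simp add: algebra_simps)
    ultimately have "wm * (real c1 - real d1) = 0" "wp * (real c2 - real d2) = 0"
      using that(1) by linarith+
    then show False using that(2) w by simp
  next
    case False
    then have "0 < real d2 - real c2" "real c1 - real d1 \<le> real d2 - real c2" using that by auto
    then have "wm * (real c1 - real d1) \<le> wm * (real d2 - real c2)"
      "wm * (real d2 - real c2) < wp * (real d2 - real c2)" using w by auto
    then show False using that(1) by linarith
  qed
  have sum: "a1 + a2 + b1 + b2 = 4" using ab by (simp add: idx4_def e)
  then have sum': "b1 + b2 + a1 + a2 = 4" by simp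
  have large: "c1 = 3 \<and> c2 = 0 \<and> d1 = 0 \<and> d2 = 1"
    if "c1 + c2 + d1 + d2 = 4" "c1 > d1" "d2 > c2" "c1 - d1 > d2 - c2" for c1 c2 d1 d2 :: nat
  proof -
    define j k where "j = c1 - d1" and "k = d2 - c2"
    with that have jk: "c1 = d1 + j" "d2 = c2 + k" "j > k" "k \<ge> 1" by simp_all
    \<comment> \<open>In this form \<open>j + k\<close> is visibly even and at most 4, so j > k >= 1
      leaves only j = 3 and k = 1.\<close>
    have *: "2 * (d1 + c2) + j + k = 4" using that(1) unfolding jk by simp
    then have k: "k = 1" using jk(3,4) by linarith
    have "d1 = 0" "c2 = 0"
      using * k jk(3) by auto
    then show ?thesis using * by (simp add: jk(1,2) k)
  qed
  \<comment> \<open>\<open>?P\<close> and \<open>?Q\<close> are the order conditions of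
    \<open>gen\<close> for the pair and for its exchange; when both fail, \<open>large\<close>
    identifies a resonant pair.\<close>
  let ?P = "a1 \<ge> b1 \<and> (a2 \<ge> b2 \<or> a1 - b1 \<le> b2 - a2)"
  let ?Q = "b1 \<ge> a1 \<and> (b2 \<ge> a2 \<or> b1 - a1 \<le> a2 - b2)"
  have "a1 > b1 \<and> b2 > a2 \<and> a1 - b1 > b2 - a2 \<or> b1 > a1 \<and> a2 > b2 \<and> b1 - a1 > a2 - b2"
    if "\<not> ?P" "\<not> ?Q"
    using that less_asym unfolding de_Morgan_conj de_Morgan_disj not_le by blast
  then consider ?P | ?Q | "a1 = 3 \<and> a2 = 0 \<and> b1 = 0 \<and> b2 = 1" | "b1 = 3 \<and> b2 = 0 \<and> a1 = 0 \<and> a2 = 1"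
    using large[OF sum] large[OF sum'] by blast
  then show False
  proof cases
    case 1
    show False by (rule gen[of a1 b1 b2 a2]) (use 0 1 ab in \<open>auto simp: e algebra_simps\<close>)
  next
    case 2
    show False by (rule gen[of b1 a1 a2 b2]) (use 0 2 ab in \<open>auto simp: e algebra_simps\<close>)
  next
    case 3
    with 0 res show False by (auto simp: e resonant_pairs_def)
  next
    case 4
    with 0 res show False by (auto simp: e resonant_pairs_def)
  qed
qed

lemma Gcoef_commute: "Gcoef wm wp Phi M3 N3 a b = Gcoef wm wp Phi M3 N3 b a"
  using binomial_symmetric[of "fst a" "fst a + fst b"] binomial_symmetric[of "snd a" "snd a + snd b"]
  by (simp add: Gcoef_def add.commute)

lemma omdot_commute: "omdot wm wp b a = - omdot wm wp a b"
  by (simp add: omdot_def algebra_simps)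

text \<open>Exchanging the indices fixes \<open>Gcoef\<close> and flips the divisor, just as
  conjugation flips the factor i. Where the divisor is 0, both quotients are 0 by
  convention.\<close>

lemma cnj_S_coef: "cnj (S_coef wm wp Phi M3 N3 a b) = S_coef wm wp Phi M3 N3 b a"
  unfolding S_coef_def omdot_commute[of wm wp b a] Gcoef_commute[of wm wp Phi M3 N3 b a] by simp

lemma cnj_Sres_coef: "cnj (Sres_coef wm wp Phi M3 N3 a b) = Sres_coef wm wp Phi M3 N3 b a"
  unfolding Sres_coef_eq omdot_commute[of wm wp b a] Gcoef_commute[of wm wp Phi M3 N3 b a]
    resonant_pairs_commute[of b a] by simp

section \<open>Normal form terms and cancellation in the homological equation\<close>

lemma mono_diag: "mono a a z = complex_of_real (cmod (fst z) ^ (2 * fst a) * cmod (snd z) ^ (2 * snd a))"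
proof -
  have "complex_of_real (cmod x ^ (2 * n)) = x ^ n * cnj x ^ n" for x n
    by (simp only: power_mult of_real_power[of "cmod x ^ 2"] complex_norm_square power_mult_distrib)
  then show ?thesis by (simp only: mono_def of_real_mult mult_ac)
qed

lemma H4bar_eq:
  "H4bar wm wp Phi M3 N3 z =
    (\<Sum>(a, b)\<in>idx4. if a = b then complex_of_real (Gcoef wm wp Phi M3 N3 a b) * mono a b z else 0)"
proof -
  have "H4bar wm wp Phi M3 N3 z = (\<Sum>(a, b)\<in>{p \<in> idx4. fst p = snd p}.
      complex_of_real (Gcoef wm wp Phi M3 N3 a b) * mono a b z)"
    unfolding H4bar_def
    by (rule sum.reindex_bij_witness[of _ fst "\<lambda>a. (a, a)"])
      (auto simp: idx4_def mono_diag mult.assoc)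
  also have "\<dots> = (\<Sum>(a, b)\<in>idx4. if a = b then complex_of_real (Gcoef wm wp Phi M3 N3 a b) * mono a b z else 0)"
    by (subst sum.inter_filter[OF finite_idx4]) (auto intro!: sum.cong)
  finally show ?thesis .
qed

lemma H4res_eq:
  "H4res wm wp Phi M3 N3 z = (\<Sum>(a, b)\<in>idx4.
    if a = b \<or> (a, b) \<in> resonant_pairs
    then complex_of_real (Gcoef wm wp Phi M3 N3 a b) * mono a b z else 0)"
proof -
  let ?R = resonant_pairs
  let ?t = "\<lambda>a b. complex_of_real (Gcoef wm wp Phi M3 N3 a b) * mono a b z"
  have "?R \<subseteq> idx4" by (simp add: resonant_pairs_def idx4_def)
  then have "(\<Sum>(a, b)\<in>idx4. if (a, b) \<in> ?R then ?t a b else 0) = (\<Sum>(a, b)\<in>?R. ?t a b)"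
    by (intro sum.mono_neutral_cong_right[OF finite_idx4]) (auto split: prod.splits)
  also have "\<dots> = ?t (3,0) (0,1) + ?t (0,1) (3,0)"
    by (simp add: resonant_pairs_def)
  finally have "H4res wm wp Phi M3 N3 z = (\<Sum>(a, b)\<in>idx4. if a = b then ?t a b else 0)
      + (\<Sum>(a, b)\<in>idx4. if (a, b) \<in> ?R then ?t a b else 0)"
    unfolding H4res_def H4bar_eq by (simp add: mono_def mult.assoc)
  \<comment> \<open>Diagonal and resonant pairs are disjoint, so no monomial is counted
    twice.\<close>
  also have "\<dots> = (\<Sum>(a, b)\<in>idx4. if a = b \<or> (a, b) \<in> ?R then ?t a b else 0)"
    unfolding sum.distrib[symmetric] by (intro sum.cong) (auto simp: resonant_pairs_irrefl)
  finally show ?thesis .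
qed

text \<open>\<open>P\<close> marks the monomials that are kept. On the others the bracket multiplies
  by i times the divisor, and i * i = -1 turns the coefficient of the generator into minus that of
  the potential.\<close>

lemma homological_equation:
  assumes w: "wm > 0" "wp > 0"
    and c: "\<And>a b. c a b = (if P a b then 0 else \<i> * complex_of_real (Gcoef wm wp Phi M3 N3 a b / omdot wm wp a b))"
    and nz: "\<And>a b. (a, b) \<in> idx4 \<Longrightarrow> \<not> P a b \<Longrightarrow> omdot wm wp a b \<noteq> 0"
  shows "Gham wm wp Phi M3 N3 z + pbracket (qpoly c) (Nham wm wp) z =
    (\<Sum>(a, b)\<in>idx4. if P a b then complex_of_real (Gcoef wm wp Phi M3 N3 a b) * mono a b z else 0)"
  unfolding Gham_eq_qpoly[OF w] pbracket_qpoly_Nham unfolding qpoly_def sum.distrib[symmetric]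
  by (intro sum.cong) (auto simp: c nz)

theorem theorem4p2:
  fixes M K Phi :: "real^2^2" and M3 N3 wm wp :: real
  assumes M_sym: "transpose M = M"
    and M_pd: "\<forall>v. v \<noteq> 0 \<longrightarrow> v \<bullet> (M *v v) > 0"
    and K_diag: "\<forall>i j. i \<noteq> j \<longrightarrow> K $ i $ j = 0"
    and K_pd: "\<forall>i. K $ i $ i > 0"
    and w_pos: "0 < wm" and w_lt: "wm < wp"
    and eigs: "\<forall>lam::real. (\<exists>v. v \<noteq> 0 \<and> (matrix_inv M ** K) *v v = lam *s v)
                     \<longleftrightarrow> (lam = wm ^ 2 \<or> lam = wp ^ 2)"
    and Phi_M: "transpose Phi ** M ** Phi = mat 1"
    and Phi_K: "transpose Phi ** K ** Phi =
                 (\<chi> i j. if i = j then (if i = 1 then wm ^ 2 else wp ^ 2) else 0)"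
  defines "N \<equiv> Nham wm wp"
    and "G \<equiv> Gham wm wp Phi M3 N3"
    and "H \<equiv> (\<lambda>z. Nham wm wp z + Gham wm wp Phi M3 N3 z)"
    and "Sres \<equiv> qpoly (Sres_coef wm wp Phi M3 N3)"
    and "S \<equiv> qpoly (S_coef wm wp Phi M3 N3)"
  shows
    "(\<forall>z. G z + pbracket Sres N z = H4res wm wp Phi M3 N3 z) \<and>
     (\<exists>r>0. \<exists>C.
        (\<forall>z. maxnorm z < r \<longrightarrow> (\<exists>y. flow_sol Sres z y)) \<and>
        inj_on (flow1 Sres) {z. maxnorm z < r} \<and>
        (\<forall>z. maxnorm z < r \<longrightarrow> (\<exists>D. (flow1 Sres has_derivative D) (at z) \<and>
              (\<forall>u v. sympl (D u) (D v) = sympl u v))) \<and>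
        (\<forall>z. maxnorm z < r \<longrightarrow> maxnorm (flow1 Sres z - z) \<le> C * maxnorm z ^ 3) \<and>
        (\<forall>z. maxnorm z < r \<longrightarrow>
              cmod (H (flow1 Sres z) - N z - H4res wm wp Phi M3 N3 z) \<le> C * maxnorm z ^ 6)) \<and>
    (wp \<noteq> 3 * wm \<longrightarrow>
     (\<forall>z. G z + pbracket S N z = H4bar wm wp Phi M3 N3 z) \<and>
     (\<exists>r>0. \<exists>C.
        (\<forall>z. maxnorm z < r \<longrightarrow> (\<exists>y. flow_sol S z y)) \<and>
        inj_on (flow1 S) {z. maxnorm z < r} \<and>
        (\<forall>z. maxnorm z < r \<longrightarrow> (\<exists>D. (flow1 S has_derivative D) (at z) \<and>
              (\<forall>u v. sympl (D u) (D v) = sympl u v))) \<and>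
        (\<forall>z. maxnorm z < r \<longrightarrow> maxnorm (flow1 S z - z) \<le> C * maxnorm z ^ 3) \<and>
        (\<forall>z. maxnorm z < r \<longrightarrow>
              cmod (H (flow1 S z) - N z - H4bar wm wp Phi M3 N3 z) \<le> C * maxnorm z ^ 6)))"
proof -
  have wp: "wp > 0" using w_pos w_lt by simp
  have H: "H = (\<lambda>z. N z + G z)" by (simp add: H_def N_def G_def)
  have N: "hpoly 2 N" unfolding N_def by (rule hpoly_Nham)
  have G: "hpoly 4 G" unfolding G_def Gham_eq_qpoly[OF w_pos wp] by (rule hpoly_qpoly)
  \<comment> \<open>Diagonal and resonant monomials are kept, so the remaining divisors are nonzero
    for every ratio of the frequencies.\<close>
  have hom_res: "G z + pbracket Sres N z = H4res wm wp Phi M3 N3 z" for z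
    unfolding G_def Sres_def N_def H4res_eq
    by (rule homological_equation[OF w_pos wp])
      (use omdot_nonzero[OF w_pos w_lt] in \<open>auto simp: Sres_coef_eq\<close>)
  have real_res: "Im (Sres z) = 0" for z
    unfolding Sres_def by (rule qpoly_real[OF cnj_Sres_coef])
  have res: "near_identity_normal_form Sres H N (H4res wm wp Phi M3 N3)"
    unfolding H
    by (rule normal_form[OF _ real_res N G hom_res]) (simp add: Sres_def hpoly_qpoly)
  \<comment> \<open>Only the diagonal is kept; excluding the ratio 3 makes the divisors of the
    resonant pairs nonzero too.\<close>
  have hom: "G z + pbracket S N z = H4bar wm wp Phi M3 N3 z" if "wp \<noteq> 3 * wm" for z
    unfolding G_def S_def N_def H4bar_eq
    by (rule homological_equation[OF w_pos wp])
      (use that omdot_nonzero[OF w_pos w_lt] in \<open>auto simp: S_coef_def\<close>)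
  have real: "Im (S z) = 0" for z
    unfolding S_def by (rule qpoly_real[OF cnj_S_coef])
  have nonres: "near_identity_normal_form S H N (H4bar wm wp Phi M3 N3)" if "wp \<noteq> 3 * wm"
    unfolding H
    by (rule normal_form[OF _ real N G hom[OF that]]) (simp add: S_def hpoly_qpoly)
  show ?thesis
    using hom_res res hom nonres unfolding near_identity_normal_form_def by blast
qed

end
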